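(* Let each of $\mathcal{C}_1,\dots,\mathcal{C}_n,\mathcal{D}$ be a category of $\sigma$-structures or pointed $\sigma$-structures, let $\mathbb{C}_i$ be comonads on $\mathcal{C}_i$ and $\mathbb{D}$ a comonad on $\mathcal{D}$ that preserves embeddings, and let $H\colon\prod_i\mathcal{C}_i\to\mathcal{D}$ be a functor which preserves embeddings. If there exists a Kleisli law $\kappa\colon\mathbb{D}\circ H\Rightarrow H\circ\prod_i\mathbb{C}_i$ satisfying (S2'), then for all $A_i,B_i\in\mathcal{C}_i$: if $A_i\equiv_{\mathbb{C}_i}B_i$ for all $i=1,\dots,n$, then $H(A_1,\dots,A_n)\equiv_{\mathbb{D}}H(B_1,\dots,B_n)$.
   Context: Embedding: injective homomorphism reflecting relations; a functor preserves embeddings if it sends (tuples of) embeddings to embeddings. Kleisli law: natural transformation $\kappa_{\vec A}\colon\mathbb{D}H(\vec A)\to H(\vec{\mathbb{C}_iA_i})$ with $H(\vec\varepsilon)\circ\kappa=\varepsilon_H$ and $\kappa_{\vec{\mathbb{C}A}}\circ\mathbb{D}(\kappa)\circ\delta_H=H(\vec\delta)\circ\kappa$. $\mathrm{EM}(\mathbb{C})$: Eilenberg–Moore coalgebras $(A,\alpha)$; cofree coalgebra $F^{\mathbb{C}}(A)=(\mathbb{C}A,\delta_A)$. In each $\mathrm{EM}$ category a class of coalgebras called paths is fixed; coalgebra embeddings are coalgebra morphisms with underlying embedding; path embeddings are embeddings with domain a path. A coalgebra morphism $f\colon X\to Y$ is a pathwise-embedding if $f\circ e$ is an embedding for every path embedding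 $e$ into $X$, and open if whenever $f\circ e=m\circ g$ with $e\colon P\to X$, $m\colon Q\to Y$ path embeddings, there is $d\colon Q\to X$ with $e=d\circ g$, $m=f\circ d$. $A\equiv_{\mathbb{C}}B$ iff there is a span $F^{\mathbb{C}}(A)\leftarrow X\rightarrow F^{\mathbb{C}}(B)$ of open pathwise-embeddings in $\mathrm{EM}(\mathbb{C})$. (S2'): for any path $(P,\pi)\in\mathrm{EM}(\mathbb{D})$ and coalgebras $(A_i,\alpha_i)\in\mathrm{EM}(\mathbb{C}_i)$, every $f\colon P\to H(\vec A)$ with $H(\vec\alpha)\circ f=\kappa\circ\mathbb{D}(f)\circ\pi$ has a minimal decomposition $f=H(e_1,\dots,e_n)\circ f_0$ with path embeddings $e_i\colon(P_i,\pi_i)\to(A_i,\alpha_i)$, minimal meaning that for any other such decomposition $f=H(\vec g)\circ g_0$ with path embeddings $g_i\colon(Q_i,\rho_i)\to(A_i,\alpha_i)$ there are coalgebra morphisms $h_i$ with $e_i=g_i\circ h_i$.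
   Formalization: In (S2') the factors f_0 and g_0 must satisfy the same equation with κ as f, relative to the path coalgebras; automatic if the comonads C_i preserve embeddings, and without it the claim fails. Here n ≥ 1 and all structures have carriers in a fixed (arbitrary) universe. *)

theory Defs
  imports Main "HOL-Library.FuncSet"
begin

section \<open>Categories, functors and natural transformations\<close>

text \<open>Equations between arrows are only ever imposed on composable arrows; the fields are
  unconstrained outside the objects and arrows of the category.\<close>

record ('o, 'm) category =
  Obj :: "'o set"
  Arr :: "'m set"
  Dom :: "'m \<Rightarrow> 'o"
  Cod :: "'m \<Rightarrow> 'o"
  Ident :: "'o \<Rightarrow> 'm"
  Comp :: "'m \<Rightarrow> 'm \<Rightarrow> 'm"  (infixr "\<cdot>\<index>" 70)

definition Hom :: "('o, 'm) category \<Rightarrow> 'o \<Rightarrow> 'o \<Rightarrow> 'm set" where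
  "Hom C A B = {f \<in> Arr C. Dom C f = A \<and> Cod C f = B}"

definition category :: "('o, 'm) category \<Rightarrow> bool" where
  "category C \<longleftrightarrow>
    (\<forall>f\<in>Arr C. Dom C f \<in> Obj C \<and> Cod C f \<in> Obj C) \<and>
    (\<forall>A\<in>Obj C. Ident C A \<in> Hom C A A) \<and>
    (\<forall>f\<in>Arr C. \<forall>g\<in>Arr C. Cod C f = Dom C g \<longrightarrow> g \<cdot>\<^bsub>C\<^esub> f \<in> Hom C (Dom C f) (Cod C g)) \<and>
    (\<forall>f\<in>Arr C. f \<cdot>\<^bsub>C\<^esub> Ident C (Dom C f) = f \<and> Ident C (Cod C f) \<cdot>\<^bsub>C\<^esub> f = f) \<and>
    (\<forall>f\<in>Arr C. \<forall>g\<in>Arr C. \<forall>h\<in>Arr C. Cod C f = Dom C g \<longrightarrow> Cod C g = Dom C h \<longrightarrow>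
      h \<cdot>\<^bsub>C\<^esub> (g \<cdot>\<^bsub>C\<^esub> f) = (h \<cdot>\<^bsub>C\<^esub> g) \<cdot>\<^bsub>C\<^esub> f)"

record ('o, 'm, 'p, 'q) functor_data =
  ob :: "'o \<Rightarrow> 'p"
  ar :: "'m \<Rightarrow> 'q"

definition is_functor ::
  "('o, 'm) category \<Rightarrow> ('p, 'q) category \<Rightarrow> ('o, 'm, 'p, 'q) functor_data \<Rightarrow> bool" where
  "is_functor C D F \<longleftrightarrow>
    (\<forall>A\<in>Obj C. ob F A \<in> Obj D) \<and>
    (\<forall>f\<in>Arr C. ar F f \<in> Hom D (ob F (Dom C f)) (ob F (Cod C f))) \<and>
    (\<forall>A\<in>Obj C. ar F (Ident C A) = Ident D (ob F A)) \<and>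
    (\<forall>f\<in>Arr C. \<forall>g\<in>Arr C. Cod C f = Dom C g \<longrightarrow> ar F (g \<cdot>\<^bsub>C\<^esub> f) = ar F g \<cdot>\<^bsub>D\<^esub> ar F f)"

definition identity_functor :: "('o, 'm, 'o, 'm) functor_data" where
  "identity_functor = \<lparr>ob = id, ar = id\<rparr>"

definition comp_functor ::
  "('p, 'q, 'x, 'y) functor_data \<Rightarrow> ('o, 'm, 'p, 'q) functor_data \<Rightarrow> ('o, 'm, 'x, 'y) functor_data"
  (infixr "\<circ>\<^sub>F" 60) where
  "G \<circ>\<^sub>F F = \<lparr>ob = ob G \<circ> ob F, ar = ar G \<circ> ar F\<rparr>"

definition nat_trans :: "('o, 'm) category \<Rightarrow> ('p, 'q) category \<Rightarrow>
    ('o, 'm, 'p, 'q) functor_data \<Rightarrow> ('o, 'm, 'p, 'q) functor_data \<Rightarrow> ('o \<Rightarrow> 'q) \<Rightarrow> bool" where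
  "nat_trans C D F G \<eta> \<longleftrightarrow>
    (\<forall>A\<in>Obj C. \<eta> A \<in> Hom D (ob F A) (ob G A)) \<and>
    (\<forall>f\<in>Arr C. \<eta> (Cod C f) \<cdot>\<^bsub>D\<^esub> ar F f = ar G f \<cdot>\<^bsub>D\<^esub> \<eta> (Dom C f))"

definition product_category :: "('i \<Rightarrow> ('o, 'm) category) \<Rightarrow> ('i \<Rightarrow> 'o, 'i \<Rightarrow> 'm) category" where
  "product_category C =
    \<lparr>Obj = {A. \<forall>i. A i \<in> Obj (C i)},
     Arr = {f. \<forall>i. f i \<in> Arr (C i)},
     Dom = (\<lambda>f i. Dom (C i) (f i)),
     Cod = (\<lambda>f i. Cod (C i) (f i)),
     Ident = (\<lambda>A i. Ident (C i) (A i)),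
     Comp = (\<lambda>g f i. g i \<cdot>\<^bsub>C i\<^esub> f i)\<rparr>"

definition product_functor ::
  "('i \<Rightarrow> ('o, 'm, 'p, 'q) functor_data) \<Rightarrow> ('i \<Rightarrow> 'o, 'i \<Rightarrow> 'm, 'i \<Rightarrow> 'p, 'i \<Rightarrow> 'q) functor_data" where
  "product_functor F = \<lparr>ob = (\<lambda>A i. ob (F i) (A i)), ar = (\<lambda>f i. ar (F i) (f i))\<rparr>"


section \<open>Comonads and their Eilenberg--Moore coalgebras\<close>

record ('o, 'm) comonad_data =
  endo :: "('o, 'm, 'o, 'm) functor_data"
  counit :: "'o \<Rightarrow> 'm"
  comult :: "'o \<Rightarrow> 'm"

definition comonad :: "('o, 'm) category \<Rightarrow> ('o, 'm) comonad_data \<Rightarrow> bool" where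
  "comonad C T \<longleftrightarrow>
    is_functor C C (endo T) \<and>
    nat_trans C C (endo T) identity_functor (counit T) \<and>
    nat_trans C C (endo T) (endo T \<circ>\<^sub>F endo T) (comult T) \<and>
    (\<forall>A\<in>Obj C.
      counit T (ob (endo T) A) \<cdot>\<^bsub>C\<^esub> comult T A = Ident C (ob (endo T) A) \<and>
      ar (endo T) (counit T A) \<cdot>\<^bsub>C\<^esub> comult T A = Ident C (ob (endo T) A) \<and>
      comult T (ob (endo T) A) \<cdot>\<^bsub>C\<^esub> comult T A = ar (endo T) (comult T A) \<cdot>\<^bsub>C\<^esub> comult T A)"

type_synonym ('o, 'm) coalg = "'o \<times> 'm"

type_synonym ('o, 'm) coalg_arr = "('o, 'm) coalg \<times> 'm \<times> ('o, 'm) coalg"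

definition coalgebras :: "('o, 'm) category \<Rightarrow> ('o, 'm) comonad_data \<Rightarrow> ('o, 'm) coalg set" where
  "coalgebras C T =
    {(A, \<alpha>). A \<in> Obj C \<and> \<alpha> \<in> Hom C A (ob (endo T) A) \<and>
       counit T A \<cdot>\<^bsub>C\<^esub> \<alpha> = Ident C A \<and>
       comult T A \<cdot>\<^bsub>C\<^esub> \<alpha> = ar (endo T) \<alpha> \<cdot>\<^bsub>C\<^esub> \<alpha>}"

abbreviation underlying :: "('o, 'm) coalg_arr \<Rightarrow> 'm" where
  "underlying f \<equiv> fst (snd f)"

definition EM :: "('o, 'm) category \<Rightarrow> ('o, 'm) comonad_data \<Rightarrow>
    (('o, 'm) coalg, ('o, 'm) coalg_arr) category" where
  "EM C T =
    \<lparr>Obj = coalgebras C T,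
     Arr = {(X, f, Y). X \<in> coalgebras C T \<and> Y \<in> coalgebras C T \<and> f \<in> Hom C (fst X) (fst Y) \<and>
              snd Y \<cdot>\<^bsub>C\<^esub> f = ar (endo T) f \<cdot>\<^bsub>C\<^esub> snd X},
     Dom = fst,
     Cod = (\<lambda>f. snd (snd f)),
     Ident = (\<lambda>X. (X, Ident C (fst X), X)),
     Comp = (\<lambda>g f. (fst f, underlying g \<cdot>\<^bsub>C\<^esub> underlying f, snd (snd g)))\<rparr>"

definition cofree :: "('o, 'm) comonad_data \<Rightarrow> 'o \<Rightarrow> ('o, 'm) coalg" where
  "cofree T A = (ob (endo T) A, comult T A)"


section \<open>Open pathwise-embeddings\<close>

text \<open>Here \<open>E\<close> is a category with a class \<open>M\<close> of arrows (the embeddings) and a class \<open>P\<close> of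
  objects (the paths).\<close>

definition path_embedding :: "('o, 'm) category \<Rightarrow> 'm set \<Rightarrow> 'o set \<Rightarrow> 'm \<Rightarrow> bool" where
  "path_embedding E M P e \<longleftrightarrow> e \<in> Arr E \<and> e \<in> M \<and> Dom E e \<in> P"

definition pathwise_embedding :: "('o, 'm) category \<Rightarrow> 'm set \<Rightarrow> 'o set \<Rightarrow> 'm \<Rightarrow> bool" where
  "pathwise_embedding E M P f \<longleftrightarrow> f \<in> Arr E \<and>
    (\<forall>e. path_embedding E M P e \<longrightarrow> Cod E e = Dom E f \<longrightarrow> f \<cdot>\<^bsub>E\<^esub> e \<in> M)"

definition open_arrow :: "('o, 'm) category \<Rightarrow> 'm set \<Rightarrow> 'o set \<Rightarrow> 'm \<Rightarrow> bool" where
  "open_arrow E M P f \<longleftrightarrow> f \<in> Arr E \<and>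
    (\<forall>e m g. path_embedding E M P e \<longrightarrow> Cod E e = Dom E f \<longrightarrow>
       path_embedding E M P m \<longrightarrow> Cod E m = Cod E f \<longrightarrow>
       g \<in> Hom E (Dom E e) (Dom E m) \<longrightarrow> f \<cdot>\<^bsub>E\<^esub> e = m \<cdot>\<^bsub>E\<^esub> g \<longrightarrow>
       (\<exists>d \<in> Hom E (Dom E m) (Dom E f). e = d \<cdot>\<^bsub>E\<^esub> g \<and> m = f \<cdot>\<^bsub>E\<^esub> d))"


section \<open>Kleisli laws\<close>

definition kleisli_law :: "('i \<Rightarrow> ('o, 'm) category) \<Rightarrow> ('p, 'q) category \<Rightarrow>
    ('i \<Rightarrow> ('o, 'm) comonad_data) \<Rightarrow> ('p, 'q) comonad_data \<Rightarrow>
    ('i \<Rightarrow> 'o, 'i \<Rightarrow> 'm, 'p, 'q) functor_data \<Rightarrow> (('i \<Rightarrow> 'o) \<Rightarrow> 'q) \<Rightarrow> bool" where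
  "kleisli_law C D S T H \<kappa> \<longleftrightarrow>
    nat_trans (product_category C) D
      (endo T \<circ>\<^sub>F H) (H \<circ>\<^sub>F product_functor (\<lambda>i. endo (S i))) \<kappa> \<and>
    (\<forall>A\<in>Obj (product_category C).
      ar H (\<lambda>i. counit (S i) (A i)) \<cdot>\<^bsub>D\<^esub> \<kappa> A = counit T (ob H A) \<and>
      \<kappa> (\<lambda>i. ob (endo (S i)) (A i)) \<cdot>\<^bsub>D\<^esub> ar (endo T) (\<kappa> A) \<cdot>\<^bsub>D\<^esub> comult T (ob H A) =
        ar H (\<lambda>i. comult (S i) (A i)) \<cdot>\<^bsub>D\<^esub> \<kappa> A)"

text \<open>The arrows \<open>f: P \<rightarrow> H(A\<^sub>1,\<dots>,A\<^sub>n)\<close> with \<open>H(\<alpha>\<^sub>1,\<dots>,\<alpha>\<^sub>n) \<circ> f = \<kappa> \<circ> T f \<circ> \<pi>\<close>, for \<open>X\<^sub>i = (A\<^sub>i, \<alpha>\<^sub>i)\<close>.\<close>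

definition compatible :: "('p, 'q) category \<Rightarrow> ('p, 'q) comonad_data \<Rightarrow>
    ('i \<Rightarrow> 'o, 'i \<Rightarrow> 'm, 'p, 'q) functor_data \<Rightarrow> (('i \<Rightarrow> 'o) \<Rightarrow> 'q) \<Rightarrow>
    ('p, 'q) coalg \<Rightarrow> ('i \<Rightarrow> ('o, 'm) coalg) \<Rightarrow> 'q set" where
  "compatible D T H \<kappa> P X =
    {f \<in> Hom D (fst P) (ob H (\<lambda>i. fst (X i))).
       ar H (\<lambda>i. snd (X i)) \<cdot>\<^bsub>D\<^esub> f =
         \<kappa> (\<lambda>i. fst (X i)) \<cdot>\<^bsub>D\<^esub> ar (endo T) f \<cdot>\<^bsub>D\<^esub> snd P}"


section \<open>Structures and pointed structures\<close>

record 'r signature =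
  symbols :: "'r set"
  arity :: "'r \<Rightarrow> nat"
  pointed :: bool

datatype ('a, 'r) struc =
  Struc (carrier: "'a set") (rel: "'r \<Rightarrow> 'a list set") (point: "'a option")

text \<open>Carriers may be empty, except that a pointed structure contains its point. Symbols outside
  the signature are interpreted by the empty set, so that they carry no information.\<close>

definition structures :: "'r signature \<Rightarrow> ('a, 'r) struc set" where
  "structures \<sigma> = {A.
     (\<forall>R\<in>symbols \<sigma>. rel A R \<subseteq> {xs. length xs = arity \<sigma> R \<and> set xs \<subseteq> carrier A}) \<and>
     (\<forall>R. R \<notin> symbols \<sigma> \<longrightarrow> rel A R = {}) \<and>
     (if pointed \<sigma> then \<exists>a\<in>carrier A. point A = Some a else point A = None)}"

datatype ('a, 'r) morph =
  Morph (src: "('a, 'r) struc") (fn: "'a \<Rightarrow> 'a") (tgt: "('a, 'r) struc")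

definition homomorphisms :: "'r signature \<Rightarrow> ('a, 'r) morph set" where
  "homomorphisms \<sigma> = {f.
     src f \<in> structures \<sigma> \<and> tgt f \<in> structures \<sigma> \<and>
     fn f \<in> carrier (src f) \<rightarrow>\<^sub>E carrier (tgt f) \<and>
     (\<forall>R\<in>symbols \<sigma>. \<forall>xs\<in>rel (src f) R. map (fn f) xs \<in> rel (tgt f) R) \<and>
     map_option (fn f) (point (src f)) = point (tgt f)}"

definition embeddings :: "'r signature \<Rightarrow> ('a, 'r) morph set" where
  "embeddings \<sigma> = {f \<in> homomorphisms \<sigma>.
     inj_on (fn f) (carrier (src f)) \<and>
     (\<forall>R\<in>symbols \<sigma>. \<forall>xs. length xs = arity \<sigma> R \<longrightarrow> set xs \<subseteq> carrier (src f) \<longrightarrow>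
        map (fn f) xs \<in> rel (tgt f) R \<longrightarrow> xs \<in> rel (src f) R)}"

text \<open>The category of \<open>\<sigma>\<close>-structures, or of pointed \<open>\<sigma>\<close>-structures if \<open>pointed \<sigma>\<close>; the type
  \<open>'a\<close> is the universe in which all carriers live.\<close>

definition Str :: "'r signature \<Rightarrow> (('a, 'r) struc, ('a, 'r) morph) category" where
  "Str \<sigma> =
    \<lparr>Obj = structures \<sigma>,
     Arr = homomorphisms \<sigma>,
     Dom = src,
     Cod = tgt,
     Ident = (\<lambda>A. Morph A (\<lambda>x\<in>carrier A. x) A),
     Comp = (\<lambda>g f. Morph (src f) (compose (carrier (src f)) (fn g) (fn f)) (tgt g))\<rparr>"

type_synonym ('a, 'r) str_comonad = "(('a, 'r) struc, ('a, 'r) morph) comonad_data"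

type_synonym ('a, 'r) str_coalg = "(('a, 'r) struc, ('a, 'r) morph) coalg"

type_synonym ('a, 'r) str_coalg_arr = "(('a, 'r) struc, ('a, 'r) morph) coalg_arr"

text \<open>Functors \<open>\<Prod>\<^sub>i Str (\<sigma>\<^sub>i) \<rightarrow> Str \<tau>\<close>.\<close>

type_synonym ('i, 'a, 'r, 'b, 's) str_functor =
  "('i \<Rightarrow> ('a, 'r) struc, 'i \<Rightarrow> ('a, 'r) morph, ('b, 's) struc, ('b, 's) morph) functor_data"

definition comonad_preserves_embeddings ::
  "'r signature \<Rightarrow> ('a, 'r) str_comonad \<Rightarrow> bool" where
  "comonad_preserves_embeddings \<sigma> T \<longleftrightarrow> (\<forall>f\<in>embeddings \<sigma>. ar (endo T) f \<in> embeddings \<sigma>)"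

definition functor_preserves_embeddings ::
  "('i \<Rightarrow> 'r signature) \<Rightarrow> 's signature \<Rightarrow> ('i, 'a, 'r, 'b, 's) str_functor \<Rightarrow> bool" where
  "functor_preserves_embeddings \<sigma> \<tau> H \<longleftrightarrow>
    (\<forall>f. (\<forall>i. f i \<in> embeddings (\<sigma> i)) \<longrightarrow> ar H f \<in> embeddings \<tau>)"

definition coalg_embeddings ::
  "'r signature \<Rightarrow> ('a, 'r) str_comonad \<Rightarrow> ('a, 'r) str_coalg_arr set" where
  "coalg_embeddings \<sigma> T = {f \<in> Arr (EM (Str \<sigma>) T). underlying f \<in> embeddings \<sigma>}"

definition open_pathwise_embedding :: "'r signature \<Rightarrow> ('a, 'r) str_comonad \<Rightarrow>
    ('a, 'r) str_coalg set \<Rightarrow> ('a, 'r) str_coalg_arr \<Rightarrow> bool" where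
  "open_pathwise_embedding \<sigma> T paths f \<longleftrightarrow>
    open_arrow (EM (Str \<sigma>) T) (coalg_embeddings \<sigma> T) paths f \<and>
    pathwise_embedding (EM (Str \<sigma>) T) (coalg_embeddings \<sigma> T) paths f"

definition comonad_equiv :: "'r signature \<Rightarrow> ('a, 'r) str_comonad \<Rightarrow>
    ('a, 'r) str_coalg set \<Rightarrow> ('a, 'r) struc \<Rightarrow> ('a, 'r) struc \<Rightarrow> bool" where
  "comonad_equiv \<sigma> T paths A B \<longleftrightarrow>
    (\<exists>X \<in> Obj (EM (Str \<sigma>) T).
     \<exists>f \<in> Hom (EM (Str \<sigma>) T) X (cofree T A).
     \<exists>g \<in> Hom (EM (Str \<sigma>) T) X (cofree T B).
       open_pathwise_embedding \<sigma> T paths f \<and> open_pathwise_embedding \<sigma> T paths g)"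


section \<open>Minimal decompositions\<close>

text \<open>A decomposition of a compatible \<open>f: P \<rightarrow> H(A\<^sub>1,\<dots>,A\<^sub>n)\<close> takes place among compatible arrows: the
  factor \<open>f\<^sub>0: P \<rightarrow> H(P\<^sub>1,\<dots>,P\<^sub>n)\<close> satisfies the same equation as \<open>f\<close>, with respect to the coalgebra
  structures of the paths \<open>P\<^sub>i\<close>. If the comonads \<open>S i\<close> preserve embeddings, this is automatic, because
  \<open>H\<close> applied to the tuple of the \<open>S i\<close>-images of the \<open>e\<^sub>i\<close> is then injective.\<close>

definition decomposition :: "('i \<Rightarrow> 'r signature) \<Rightarrow> 's signature \<Rightarrow>
    ('i \<Rightarrow> ('a, 'r) str_comonad) \<Rightarrow> ('b, 's) str_comonad \<Rightarrow> ('i \<Rightarrow> ('a, 'r) str_coalg set) \<Rightarrow>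
    ('i, 'a, 'r, 'b, 's) str_functor \<Rightarrow> (('i \<Rightarrow> ('a, 'r) struc) \<Rightarrow> ('b, 's) morph) \<Rightarrow>
    ('b, 's) str_coalg \<Rightarrow> ('i \<Rightarrow> ('a, 'r) str_coalg) \<Rightarrow> ('b, 's) morph \<Rightarrow>
    ('i \<Rightarrow> ('a, 'r) str_coalg_arr) \<Rightarrow> ('b, 's) morph \<Rightarrow> bool" where
  "decomposition \<sigma> \<tau> S T paths H \<kappa> P X f e f0 \<longleftrightarrow>
    (\<forall>i. path_embedding (EM (Str (\<sigma> i)) (S i)) (coalg_embeddings (\<sigma> i) (S i)) (paths i) (e i) \<and>
         Cod (EM (Str (\<sigma> i)) (S i)) (e i) = X i) \<and>
    f0 \<in> compatible (Str \<tau>) T H \<kappa> P (\<lambda>i. Dom (EM (Str (\<sigma> i)) (S i)) (e i)) \<and>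
    f = ar H (\<lambda>i. underlying (e i)) \<cdot>\<^bsub>Str \<tau>\<^esub> f0"

definition S2' :: "('i \<Rightarrow> 'r signature) \<Rightarrow> 's signature \<Rightarrow>
    ('i \<Rightarrow> ('a, 'r) str_comonad) \<Rightarrow> ('b, 's) str_comonad \<Rightarrow>
    ('i \<Rightarrow> ('a, 'r) str_coalg set) \<Rightarrow> ('b, 's) str_coalg set \<Rightarrow>
    ('i, 'a, 'r, 'b, 's) str_functor \<Rightarrow> (('i \<Rightarrow> ('a, 'r) struc) \<Rightarrow> ('b, 's) morph) \<Rightarrow> bool" where
  "S2' \<sigma> \<tau> S T paths pathsD H \<kappa> \<longleftrightarrow>
    (\<forall>P\<in>pathsD. \<forall>X. (\<forall>i. X i \<in> Obj (EM (Str (\<sigma> i)) (S i))) \<longrightarrow>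
      (\<forall>f\<in>compatible (Str \<tau>) T H \<kappa> P X.
        \<exists>e f0. decomposition \<sigma> \<tau> S T paths H \<kappa> P X f e f0 \<and>
          (\<forall>g g0. decomposition \<sigma> \<tau> S T paths H \<kappa> P X f g g0 \<longrightarrow>
            (\<exists>h. \<forall>i. h i \<in> Hom (EM (Str (\<sigma> i)) (S i))
                             (Dom (EM (Str (\<sigma> i)) (S i)) (e i)) (Dom (EM (Str (\<sigma> i)) (S i)) (g i)) \<and>
                     e i = g i \<cdot>\<^bsub>EM (Str (\<sigma> i)) (S i)\<^esub> h i))))"


section \<open>The constructions above are categories\<close>

lemma category_product:
  assumes "\<And>i. category (C i)"
  shows "category (product_category C)"
  using assms unfolding category_def product_category_def Hom_def
  by (auto simp: fun_eq_iff)

lemma category_Str: "category (Str \<sigma>)"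
proof -
  have ext: "fn f \<in> extensional (carrier (src f))" if "f \<in> homomorphisms \<sigma>" for f :: "('a, 'b) morph"
    using that by (auto simp: homomorphisms_def PiE_def)
  have maps: "fn f x \<in> carrier (tgt f)" if "f \<in> homomorphisms \<sigma>" "x \<in> carrier (src f)"
    for f :: "('a, 'b) morph" and x
    using that by (auto simp: homomorphisms_def)
  have ident: "Morph A (\<lambda>x\<in>carrier A. x) A \<in> homomorphisms \<sigma>" if "A \<in> structures \<sigma>"
    for A :: "('a, 'b) struc"
  proof -
    have "map (\<lambda>x\<in>carrier A. x) xs = xs" if "R \<in> symbols \<sigma>" "xs \<in> rel A R" for R xs
      using that \<open>A \<in> structures \<sigma>\<close> by (intro map_idI) (auto simp: structures_def)
    then show ?thesis
      using that by (auto simp: homomorphisms_def structures_def split: if_splits)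
  qed
  have comp: "Morph (src f) (compose (carrier (src f)) (fn g) (fn f)) (tgt g) \<in> homomorphisms \<sigma>"
    if f: "f \<in> homomorphisms \<sigma>" and g: "g \<in> homomorphisms \<sigma>" and fg: "tgt f = src g"
    for f g :: "('a, 'b) morph"
  proof -
    let ?k = "compose (carrier (src f)) (fn g) (fn f)"
    have "map ?k xs \<in> rel (tgt g) R" if R: "R \<in> symbols \<sigma>" and xs: "xs \<in> rel (src f) R" for R xs
    proof -
      have "map ?k xs = map (fn g) (map (fn f) xs)"
        using R xs f by (auto simp: homomorphisms_def structures_def compose_def)
      also have "\<dots> \<in> rel (tgt g) R"
        using R xs f g fg unfolding homomorphisms_def by (metis (no_types, lifting) mem_Collect_eq)
      finally show ?thesis .
    qed
    moreover have "map_option ?k (point (src f)) = map_option (fn g) (map_option (fn f) (point (src f)))"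
      using f by (auto simp: homomorphisms_def structures_def compose_def split: if_splits)
    moreover have "?k \<in> carrier (src f) \<rightarrow>\<^sub>E carrier (tgt g)"
      using f g fg by (auto simp: homomorphisms_def compose_def)
    ultimately show ?thesis
      using f g fg by (auto simp: homomorphisms_def)
  qed
  have left: "Morph (src f) (compose (carrier (src f)) (\<lambda>x\<in>carrier (tgt f). x) (fn f)) (tgt f) = f"
    and right: "Morph (src f) (compose (carrier (src f)) (fn f) (\<lambda>x\<in>carrier (src f). x)) (tgt f) = f"
    if f: "f \<in> homomorphisms \<sigma>" for f :: "('a, 'b) morph"
    using ext[OF f] maps[OF f]
    by (auto intro!: morph.expand extensionalityI[where A = "carrier (src f)"] simp: compose_def)
  have assoc: "compose (carrier (src f)) (fn h) (compose (carrier (src f)) (fn g) (fn f)) =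
      compose (carrier (src f)) (compose (carrier (src g)) (fn h) (fn g)) (fn f)"
    if f: "f \<in> homomorphisms \<sigma>" and fg: "tgt f = src g" for f g h :: "('a, 'b) morph"
    using maps[OF f] fg by (auto simp: compose_def fun_eq_iff)
  have ends: "src f \<in> structures \<sigma>" "tgt f \<in> structures \<sigma>" if "f \<in> homomorphisms \<sigma>"
    for f :: "('a, 'b) morph"
    using that by (auto simp: homomorphisms_def)
  show ?thesis
    unfolding category_def Hom_def Str_def
    using ends ident comp left right assoc by simp
qed

lemma category_EM:
  assumes C: "category C" and T: "comonad C T"
  shows "category (EM C T)"
proof -
  have T_comp: "ar (endo T) (g \<cdot>\<^bsub>C\<^esub> f) = ar (endo T) g \<cdot>\<^bsub>C\<^esub> ar (endo T) f"
    if "f \<in> Arr C" "g \<in> Arr C" "Cod C f = Dom C g" for f g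
    using T that by (auto simp: comonad_def is_functor_def)
  have T_id: "ar (endo T) (Ident C A) = Ident C (ob (endo T) A)" if "A \<in> Obj C" for A
    using T that by (auto simp: comonad_def is_functor_def)
  have T_hom: "ar (endo T) f \<in> Hom C (ob (endo T) (Dom C f)) (ob (endo T) (Cod C f))"
    if "f \<in> Arr C" for f
    using T that by (auto simp: comonad_def is_functor_def)
  have assoc: "h \<cdot>\<^bsub>C\<^esub> (g \<cdot>\<^bsub>C\<^esub> f) = (h \<cdot>\<^bsub>C\<^esub> g) \<cdot>\<^bsub>C\<^esub> f"
    if "f \<in> Hom C A A'" "g \<in> Hom C A' A''" "h \<in> Hom C A'' A3" for f g h A A' A'' A3
    using C that unfolding category_def Hom_def by auto
  have comp: "g \<cdot>\<^bsub>C\<^esub> f \<in> Hom C A A''" if "f \<in> Hom C A A'" "g \<in> Hom C A' A''" for f g A A' A''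
    using C that unfolding category_def Hom_def by auto
  have ident: "Ident C A \<in> Hom C A A" if "A \<in> Obj C" for A
    using C that unfolding category_def by auto
  have unit: "f \<cdot>\<^bsub>C\<^esub> Ident C A = f" "Ident C A' \<cdot>\<^bsub>C\<^esub> f = f" if "f \<in> Hom C A A'" for f A A'
    using C that unfolding category_def Hom_def by auto
  have square: "c \<cdot>\<^bsub>C\<^esub> (g \<cdot>\<^bsub>C\<^esub> f) = ar (endo T) (g \<cdot>\<^bsub>C\<^esub> f) \<cdot>\<^bsub>C\<^esub> a"
    if "f \<in> Hom C A A'" "g \<in> Hom C A' A''"
      and a: "a \<in> Hom C A (ob (endo T) A)" and b: "b \<in> Hom C A' (ob (endo T) A')"
      and c: "c \<in> Hom C A'' (ob (endo T) A'')"
      and f: "b \<cdot>\<^bsub>C\<^esub> f = ar (endo T) f \<cdot>\<^bsub>C\<^esub> a" and g: "c \<cdot>\<^bsub>C\<^esub> g = ar (endo T) g \<cdot>\<^bsub>C\<^esub> b"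
    for f g a b c A A' A''
  proof -
    have Tf: "ar (endo T) f \<in> Hom C (ob (endo T) A) (ob (endo T) A')"
      and Tg: "ar (endo T) g \<in> Hom C (ob (endo T) A') (ob (endo T) A'')"
      using T_hom[of f] T_hom[of g] that(1,2) by (auto simp: Hom_def)
    have "c \<cdot>\<^bsub>C\<^esub> (g \<cdot>\<^bsub>C\<^esub> f) = (ar (endo T) g \<cdot>\<^bsub>C\<^esub> b) \<cdot>\<^bsub>C\<^esub> f"
      using assoc[OF that(1,2) c] g by simp
    also have "\<dots> = ar (endo T) g \<cdot>\<^bsub>C\<^esub> (ar (endo T) f \<cdot>\<^bsub>C\<^esub> a)"
      using assoc[OF that(1) b Tg] f by simp
    also have "\<dots> = (ar (endo T) g \<cdot>\<^bsub>C\<^esub> ar (endo T) f) \<cdot>\<^bsub>C\<^esub> a"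
      using assoc[OF a Tf Tg] .
    also have "ar (endo T) g \<cdot>\<^bsub>C\<^esub> ar (endo T) f = ar (endo T) (g \<cdot>\<^bsub>C\<^esub> f)"
      using T_comp[of f g] that(1,2) by (auto simp: Hom_def)
    finally show ?thesis .
  qed
  have id_arr: "(X, Ident C (fst X), X) \<in> Arr (EM C T)" if "X \<in> coalgebras C T" for X
    using that by (auto simp: EM_def coalgebras_def ident T_id unit)
  have comp_arr: "(fst f, underlying g \<cdot>\<^bsub>C\<^esub> underlying f, snd (snd g)) \<in> Arr (EM C T)"
    if "f \<in> Arr (EM C T)" "g \<in> Arr (EM C T)" "snd (snd f) = fst g" for f g
    using that unfolding EM_def by (auto intro: comp) (auto simp: coalgebras_def intro: square)
  show ?thesis
    unfolding category_def
  proof (intro conjI)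
    show "\<forall>f\<in>Arr (EM C T). Dom (EM C T) f \<in> Obj (EM C T) \<and> Cod (EM C T) f \<in> Obj (EM C T)"
      by (auto simp: EM_def)
    show "\<forall>X\<in>Obj (EM C T). Ident (EM C T) X \<in> Hom (EM C T) X X"
      using id_arr by (auto simp: EM_def Hom_def)
    show "\<forall>f\<in>Arr (EM C T). \<forall>g\<in>Arr (EM C T). Cod (EM C T) f = Dom (EM C T) g \<longrightarrow>
        g \<cdot>\<^bsub>EM C T\<^esub> f \<in> Hom (EM C T) (Dom (EM C T) f) (Cod (EM C T) g)"
      using comp_arr by (simp add: EM_def Hom_def)
    show "\<forall>f\<in>Arr (EM C T). f \<cdot>\<^bsub>EM C T\<^esub> Ident (EM C T) (Dom (EM C T) f) = f \<and>
        Ident (EM C T) (Cod (EM C T) f) \<cdot>\<^bsub>EM C T\<^esub> f = f"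
      using unit by (auto simp: EM_def)
    show "\<forall>f\<in>Arr (EM C T). \<forall>g\<in>Arr (EM C T). \<forall>h\<in>Arr (EM C T).
        Cod (EM C T) f = Dom (EM C T) g \<longrightarrow> Cod (EM C T) g = Dom (EM C T) h \<longrightarrow>
        h \<cdot>\<^bsub>EM C T\<^esub> (g \<cdot>\<^bsub>EM C T\<^esub> f) = (h \<cdot>\<^bsub>EM C T\<^esub> g) \<cdot>\<^bsub>EM C T\<^esub> f"
      using assoc by (auto simp: EM_def)
  qed
qed

end

(* Since \<DD> preserves embeddings, a union of subcoalgebras is again a subcoalgebra. This gives, for
   coalgebras X_i = (A_i, \<alpha>_i), a subcoalgebra K of the cofree coalgebra on H(A_1,...,A_n) such that
   morphisms P \<rightarrow> K correspond to the arrows P \<rightarrow> H(A_1,...,A_n) compatible with \<kappa>. A tuple of open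
   pathwise-embeddings X_i \<rightarrow> F(B_i) induces a morphism from K to the cofree coalgebra on
   H(B_1,...,B_n), which is again an open pathwise-embedding: a path P \<rightarrow> K is decomposed by (S2') into
   paths P_i \<rightarrow> X_i, to which the hypotheses on X_i \<rightarrow> F(B_i) apply, and minimality makes the two
   decompositions of a commuting square of paths comparable. Both legs of a span lift to the same K. *)
theory Submission
  imports Defs
begin

section \<open>Homomorphisms and embeddings\<close>

text \<open>The arrows from a coalgebra P into H(A_1,...,A_n) compatible with \<kappa> behave like
  morphisms into a lift of H to coalgebras, and K is the value of that lift. On cofree coalgebras
  the value is known: r \<mapsto> \<kappa> r identifies morphisms into the cofree coalgebra on
  H(B_1,...,B_n) with compatible arrows, and w goes back to the extension of H(\<epsilon>) w. So
  only the apexes of the spans call for a construction.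

  The obstacle is that (S2') speaks of arrows into H(A_1,...,A_n), while embeddings are asked for
  into K and into the cofree coalgebra. Between the two stands the counit of \<DD>, which need not
  be injective: a path embedding into K may yield a compatible arrow f that is no embedding. What
  does remain an embedding is the extension of f, that is, \<DD> f after the structure map of P. As
  \<DD> and H preserve embeddings, this property can be carried through a decomposition. Crossing
  H(\<epsilon>) is the delicate point; there \<kappa> recovers a compatible arrow from its composite
  with H(\<epsilon>).\<close>

lemma Hom_Str_iff:
  "f \<in> Hom (Str \<sigma>) A B \<longleftrightarrow> f \<in> homomorphisms \<sigma> \<and> src f = A \<and> tgt f = B"
  by (auto simp: Hom_def Str_def)

lemma Str_sel [simp]:
  "Obj (Str \<sigma>) = structures \<sigma>" "Arr (Str \<sigma>) = homomorphisms \<sigma>"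
  "Dom (Str \<sigma>) = src" "Cod (Str \<sigma>) = tgt"
  by (simp_all add: Str_def)

lemma Str_Comp [simp]:
  "src (g \<cdot>\<^bsub>Str \<sigma>\<^esub> f) = src f" "tgt (g \<cdot>\<^bsub>Str \<sigma>\<^esub> f) = tgt g"
  "x \<in> carrier (src f) \<Longrightarrow> fn (g \<cdot>\<^bsub>Str \<sigma>\<^esub> f) x = fn g (fn f x)"
  by (simp_all add: Str_def compose_def)

lemma Str_Ident [simp]: "x \<in> carrier A \<Longrightarrow> fn (Ident (Str \<sigma>) A) x = x"
  by (simp add: Str_def)

lemma Hom_Str_ends:
  assumes "f \<in> Hom (Str \<sigma>) A B"
  shows "src f = A" "tgt f = B" "A \<in> structures \<sigma>" "B \<in> structures \<sigma>"
  using assms by (auto simp: Hom_Str_iff homomorphisms_def)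

lemma Hom_Str_maps: "f \<in> Hom (Str \<sigma>) A B \<Longrightarrow> x \<in> carrier A \<Longrightarrow> fn f x \<in> carrier B"
  by (auto simp: Hom_Str_iff homomorphisms_def)

lemma Hom_Str_point: "f \<in> Hom (Str \<sigma>) A B \<Longrightarrow> map_option (fn f) (point A) = point B"
  by (auto simp: Hom_Str_iff homomorphisms_def)

lemma category_Hom_comp:
  "category C \<Longrightarrow> f \<in> Hom C A B \<Longrightarrow> g \<in> Hom C B D \<Longrightarrow> g \<cdot>\<^bsub>C\<^esub> f \<in> Hom C A D"
  by (auto simp: category_def Hom_def)

lemma Hom_Str_comp:
  "f \<in> Hom (Str \<sigma>) A B \<Longrightarrow> g \<in> Hom (Str \<sigma>) B C \<Longrightarrow> g \<cdot>\<^bsub>Str \<sigma>\<^esub> f \<in> Hom (Str \<sigma>) A C"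
  by (rule category_Hom_comp[OF category_Str])

lemma Hom_Str_assoc:
  fixes f :: "('a, 'r) morph"
  assumes "f \<in> Hom (Str \<sigma>) A B" "g \<in> Hom (Str \<sigma>) B C" "h \<in> Hom (Str \<sigma>) C D"
  shows "h \<cdot>\<^bsub>Str \<sigma>\<^esub> g \<cdot>\<^bsub>Str \<sigma>\<^esub> f = (h \<cdot>\<^bsub>Str \<sigma>\<^esub> g) \<cdot>\<^bsub>Str \<sigma>\<^esub> f"
  using assms category_Str[of \<sigma>, where 'a = 'a] unfolding category_def Hom_def by auto

lemma Hom_Str_Ident: "A \<in> structures \<sigma> \<Longrightarrow> Ident (Str \<sigma>) A \<in> Hom (Str \<sigma>) A A"
  using category_Str[of \<sigma>] unfolding category_def Str_sel by blast

lemma Hom_Str_rel: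
  "f \<in> Hom (Str \<sigma>) A B \<Longrightarrow> R \<in> symbols \<sigma> \<Longrightarrow> xs \<in> rel A R \<Longrightarrow> map (fn f) xs \<in> rel B R"
  by (auto simp: Hom_Str_iff homomorphisms_def)

lemma Hom_Str_comp_fn:
  "f \<in> Hom (Str \<sigma>) A B \<Longrightarrow> x \<in> carrier A \<Longrightarrow> fn (g \<cdot>\<^bsub>Str \<sigma>\<^esub> f) x = fn g (fn f x)"
  by (simp add: Hom_Str_iff)

text \<open>Underlying maps are extensional, so their values on the carrier determine the arrow.
  This turns the diagrams below into computations on elements.\<close>

lemma Hom_Str_eqI:
  assumes f: "f \<in> Hom (Str \<sigma>) A B" and g: "g \<in> Hom (Str \<sigma>) A B"
    and eq: "\<And>x. x \<in> carrier A \<Longrightarrow> fn f x = fn g x"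
  shows "f = g"
proof -
  have "fn f \<in> extensional (carrier A)" "fn g \<in> extensional (carrier A)"
    using f g by (auto simp: Hom_Str_iff homomorphisms_def PiE_def)
  then have "fn f = fn g"
    using eq by (rule extensionalityI)
  then show ?thesis
    using f g by (auto simp: Hom_Str_iff intro: morph.expand)
qed

lemma Hom_Str_eq_iff:
  assumes "f \<in> Hom (Str \<sigma>) A B" "g \<in> Hom (Str \<sigma>) A B"
  shows "f = g \<longleftrightarrow> (\<forall>x\<in>carrier A. fn f x = fn g x)"
  using Hom_Str_eqI[OF assms] by auto

lemma structures_point: "A \<in> structures \<sigma> \<Longrightarrow> point A = Some a \<Longrightarrow> a \<in> carrier A"
  by (auto simp: structures_def split: if_splits)

lemma structures_rel:
  "A \<in> structures \<sigma> \<Longrightarrow> xs \<in> rel A R \<Longrightarrow> R \<in> symbols \<sigma> \<and> length xs = arity \<sigma> R \<and> set xs \<subseteq> carrier A"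
  by (auto simp: structures_def)

section \<open>Calculus of embeddings and substructures\<close>

lemma embedding_inj:
  assumes "m \<in> embeddings \<sigma>" "m \<in> Hom (Str \<sigma>) A B" "x \<in> carrier A" "y \<in> carrier A" "fn m x = fn m y"
  shows "x = y"
  using assms by (auto simp: embeddings_def Hom_Str_iff dest: inj_onD)

lemma embedding_rel:
  assumes "m \<in> embeddings \<sigma>" "m \<in> Hom (Str \<sigma>) A B" "R \<in> symbols \<sigma>"
    "length xs = arity \<sigma> R" "set xs \<subseteq> carrier A" "map (fn m) xs \<in> rel B R"
  shows "xs \<in> rel A R"
  using assms by (auto simp: embeddings_def Hom_Str_iff)

text \<open>For reflection of relations, the homomorphism \<open>g\<close> first carries a relation
  from \<open>B\<close> on to \<open>C\<close>, and there the composite reflects it back to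
  \<open>A\<close>.\<close>

lemma embedding_cancel_left:
  assumes g: "g \<in> Hom (Str \<sigma>) B C" and f: "f \<in> Hom (Str \<sigma>) A B"
    and gf: "g \<cdot>\<^bsub>Str \<sigma>\<^esub> f \<in> embeddings \<sigma>"
  shows "f \<in> embeddings \<sigma>"
proof -
  have inj: "inj_on (fn (g \<cdot>\<^bsub>Str \<sigma>\<^esub> f)) (carrier A)"
    using gf f by (auto simp: embeddings_def Hom_Str_iff)
  have "inj_on (fn f) (carrier A)"
    by (rule inj_onI) (metis inj inj_onD Hom_Str_comp_fn[OF f])
  moreover have "xs \<in> rel A R"
    if R: "R \<in> symbols \<sigma>" and xs: "length xs = arity \<sigma> R" "set xs \<subseteq> carrier A"
      and rel: "map (fn f) xs \<in> rel B R" for R xs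
  proof -
    have "map (fn g) (map (fn f) xs) \<in> rel C R"
      by (rule Hom_Str_rel[OF g R rel])
    moreover have "map (fn g) (map (fn f) xs) = map (fn (g \<cdot>\<^bsub>Str \<sigma>\<^esub> f)) xs"
      using xs f by (auto simp: Hom_Str_iff)
    ultimately have "map (fn (g \<cdot>\<^bsub>Str \<sigma>\<^esub> f)) xs \<in> rel C R" by (simp only:)
    then show ?thesis
      by (rule embedding_rel[OF gf Hom_Str_comp[OF f g] R xs])
  qed
  ultimately show ?thesis
    using f by (auto simp: embeddings_def Hom_Str_iff)
qed

lemma embedding_comp:
  assumes g: "g \<in> Hom (Str \<sigma>) B C" "g \<in> embeddings \<sigma>" and f: "f \<in> Hom (Str \<sigma>) A B" "f \<in> embeddings \<sigma>"
  shows "g \<cdot>\<^bsub>Str \<sigma>\<^esub> f \<in> embeddings \<sigma>"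
proof -
  have "inj_on (fn (g \<cdot>\<^bsub>Str \<sigma>\<^esub> f)) (carrier A)"
    by (rule inj_onI)
       (metis f g embedding_inj Hom_Str_comp_fn Hom_Str_maps)
  moreover have "xs \<in> rel A R"
    if R: "R \<in> symbols \<sigma>" and xs: "length xs = arity \<sigma> R" "set xs \<subseteq> carrier A"
      and rel: "map (fn (g \<cdot>\<^bsub>Str \<sigma>\<^esub> f)) xs \<in> rel C R" for R xs
  proof -
    have "map (fn g) (map (fn f) xs) = map (fn (g \<cdot>\<^bsub>Str \<sigma>\<^esub> f)) xs"
      using xs f by (auto simp: Hom_Str_iff)
    then have "map (fn g) (map (fn f) xs) \<in> rel C R" using rel by (simp only:)
    moreover have "set (map (fn f) xs) \<subseteq> carrier B" "length (map (fn f) xs) = arity \<sigma> R"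
      using xs Hom_Str_maps[OF f(1)] by auto
    ultimately have "map (fn f) xs \<in> rel B R"
      by (intro embedding_rel[OF g(2,1) R])
    then show ?thesis
      by (rule embedding_rel[OF f(2,1) R xs])
  qed
  ultimately show ?thesis
    using Hom_Str_comp[OF f(1) g(1)] by (auto simp: embeddings_def Hom_Str_iff)
qed

lemma embedding_mono:
  assumes m: "m \<in> embeddings \<sigma>" "m \<in> Hom (Str \<sigma>) B C"
    and f: "f \<in> Hom (Str \<sigma>) A B" and g: "g \<in> Hom (Str \<sigma>) A B"
    and eq: "m \<cdot>\<^bsub>Str \<sigma>\<^esub> f = m \<cdot>\<^bsub>Str \<sigma>\<^esub> g"
  shows "f = g"
proof (rule Hom_Str_eqI[OF f g])
  fix x assume x: "x \<in> carrier A"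
  have "fn m (fn f x) = fn m (fn g x)"
    using eq x Hom_Str_comp_fn[OF f] Hom_Str_comp_fn[OF g] by metis
  then show "fn f x = fn g x"
    using embedding_inj[OF m] Hom_Str_maps[OF f x] Hom_Str_maps[OF g x] by blast
qed

text \<open>A set-theoretic factor is automatically a homomorphism: it preserves relations because
  \<open>m\<close> reflects them, and the point because \<open>m\<close> is injective. Factoring
  through an embedding is therefore a condition on images alone.\<close>

lemma embedding_factor:
  assumes m: "m \<in> embeddings \<sigma>" "m \<in> Hom (Str \<sigma>) S Y" and h: "h \<in> Hom (Str \<sigma>) Z Y"
    and image: "\<And>x. x \<in> carrier Z \<Longrightarrow> fn h x \<in> fn m ` carrier S"
  obtains k where "k \<in> Hom (Str \<sigma>) Z S" "m \<cdot>\<^bsub>Str \<sigma>\<^esub> k = h"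
proof -
  define c where "c x = (SOME y. y \<in> carrier S \<and> fn m y = fn h x)" for x
  have c: "c x \<in> carrier S \<and> fn m (c x) = fn h x" if "x \<in> carrier Z" for x
    unfolding c_def by (rule someI_ex) (use image[OF that] in auto)
  define k where "k = Morph Z (\<lambda>x\<in>carrier Z. c x) S"
  have "map (fn k) xs \<in> rel S R" if R: "R \<in> symbols \<sigma>" and xs: "xs \<in> rel Z R" for R xs
  proof -
    have Z: "set xs \<subseteq> carrier Z" "length xs = arity \<sigma> R"
      using structures_rel xs Hom_Str_ends[OF h] by metis+
    have "map (fn m) (map (fn k) xs) = map (fn h) xs"
      using Z c by (auto simp: k_def)
    then have "map (fn m) (map (fn k) xs) \<in> rel Y R"
      using Hom_Str_rel[OF h R xs] by (simp only:)
    moreover have "set (map (fn k) xs) \<subseteq> carrier S" "length (map (fn k) xs) = arity \<sigma> R"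
      using Z c by (auto simp: k_def)
    ultimately show ?thesis
      by (intro embedding_rel[OF m R])
  qed
  moreover have "map_option (fn k) (point Z) = point S"
  proof (cases "point Z")
    case None
    then show ?thesis
      using Hom_Str_point[OF h] Hom_Str_point[OF m(2)] by auto
  next
    case (Some z)
    then have z: "z \<in> carrier Z" using structures_point Hom_Str_ends[OF h] by metis
    have "map_option (fn m) (point S) = Some (fn h z)"
      using Some Hom_Str_point[OF h] Hom_Str_point[OF m(2)] by simp
    then obtain s where s: "point S = Some s" "fn m s = fn h z" by auto
    have "s \<in> carrier S" using s structures_point Hom_Str_ends[OF m(2)] by metis
    then have "c z = s"
      using embedding_inj[OF m] c[OF z] s by metis
    then show ?thesis using Some s z by (simp add: k_def)
  qed
  ultimately have k: "k \<in> Hom (Str \<sigma>) Z S"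
    using c Hom_Str_ends[OF h] Hom_Str_ends[OF m(2)]
    by (auto simp: Hom_Str_iff homomorphisms_def k_def)
  have "m \<cdot>\<^bsub>Str \<sigma>\<^esub> k = h"
    by (rule Hom_Str_eqI[OF Hom_Str_comp[OF k m(2)] h]) (use c in \<open>auto simp: k_def\<close>)
  with k that show ?thesis by blast
qed

text \<open>The point of \<open>Y\<close> is kept whether or not it lies in \<open>S\<close>; the
  result is treated as a structure only when \<open>S\<close> contains it.\<close>

definition substructure :: "('a, 'r) struc \<Rightarrow> 'a set \<Rightarrow> ('a, 'r) struc" where
  "substructure Y S = Struc S (\<lambda>R. {xs \<in> rel Y R. set xs \<subseteq> S}) (point Y)"

definition inclusion :: "('a, 'r) struc \<Rightarrow> 'a set \<Rightarrow> ('a, 'r) morph" where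
  "inclusion Y S = Morph (substructure Y S) (\<lambda>x\<in>S. x) Y"

lemma carrier_substructure [simp]: "carrier (substructure Y S) = S"
  by (simp add: substructure_def)

lemma fn_inclusion [simp]: "x \<in> S \<Longrightarrow> fn (inclusion Y S) x = x"
  by (simp add: inclusion_def)

lemma inclusion_embedding:
  assumes Y: "Y \<in> structures \<sigma>" and S: "S \<subseteq> carrier Y" "set_option (point Y) \<subseteq> S"
  shows "inclusion Y S \<in> Hom (Str \<sigma>) (substructure Y S) Y" "inclusion Y S \<in> embeddings \<sigma>"
proof -
  have map: "map (\<lambda>x\<in>S. x) xs = xs" if "set xs \<subseteq> S" for xs
    by (rule map_idI) (use that in auto)
  have "substructure Y S \<in> structures \<sigma>"
    using Y S by (auto simp: structures_def substructure_def split: if_splits)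
  moreover have "map_option (\<lambda>x\<in>S. x) (point Y) = point Y"
    using S by (cases "point Y") auto
  ultimately show "inclusion Y S \<in> Hom (Str \<sigma>) (substructure Y S) Y"
    using Y S map by (auto simp: Hom_Str_iff homomorphisms_def inclusion_def substructure_def)
  then show "inclusion Y S \<in> embeddings \<sigma>"
    using map by (auto simp: embeddings_def Hom_Str_iff inclusion_def substructure_def inj_on_def)
qed


section \<open>Coalgebras of a comonad on structures\<close>

lemma EM_sel [simp]:
  "Obj (EM C T) = coalgebras C T" "Dom (EM C T) = fst" "Cod (EM C T) = (\<lambda>f. snd (snd f))"
  "g \<cdot>\<^bsub>EM C T\<^esub> f = (fst f, underlying g \<cdot>\<^bsub>C\<^esub> underlying f, snd (snd g))"
  by (simp_all add: EM_def)

locale str_comonad =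
  fixes \<sigma> :: "'r signature" and T :: "('a, 'r) str_comonad"
  assumes comonad: "comonad (Str \<sigma>) T"
begin

abbreviation "TO \<equiv> ob (endo T)"
abbreviation "TA \<equiv> ar (endo T)"
text \<open>Eilenberg--Moore arrows are triples that carry their source and target; the bare
  morphism is what gets composed and evaluated.\<close>

abbreviation "mors X Y \<equiv> {f. (X, f, Y) \<in> Arr (EM (Str \<sigma>) T)}"

lemma TA_hom: "f \<in> Hom (Str \<sigma>) A B \<Longrightarrow> TA f \<in> Hom (Str \<sigma>) (TO A) (TO B)"
  using comonad by (auto simp: comonad_def is_functor_def Hom_def)

lemma TA_comp:
  "f \<in> Hom (Str \<sigma>) A B \<Longrightarrow> g \<in> Hom (Str \<sigma>) B C \<Longrightarrow> TA (g \<cdot>\<^bsub>Str \<sigma>\<^esub> f) = TA g \<cdot>\<^bsub>Str \<sigma>\<^esub> TA f"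
  using comonad by (auto simp: comonad_def is_functor_def Hom_def)

lemma TA_comp_fn:
  assumes "f \<in> Hom (Str \<sigma>) A B" "g \<in> Hom (Str \<sigma>) B C" "x \<in> carrier (TO A)"
  shows "fn (TA (g \<cdot>\<^bsub>Str \<sigma>\<^esub> f)) x = fn (TA g) (fn (TA f) x)"
  using TA_comp[OF assms(1,2)] Hom_Str_comp_fn[OF TA_hom[OF assms(1)] assms(3)] by simp

lemma counit_hom: "A \<in> structures \<sigma> \<Longrightarrow> counit T A \<in> Hom (Str \<sigma>) (TO A) A"
  using comonad by (auto simp: comonad_def nat_trans_def identity_functor_def)

lemma comult_hom: "A \<in> structures \<sigma> \<Longrightarrow> comult T A \<in> Hom (Str \<sigma>) (TO A) (TO (TO A))"
  using comonad by (auto simp: comonad_def nat_trans_def comp_functor_def)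

lemma counit_nat:
  assumes f: "f \<in> Hom (Str \<sigma>) A B" and x: "x \<in> carrier (TO A)"
  shows "fn (counit T B) (fn (TA f) x) = fn f (fn (counit T A) x)"
proof -
  have "counit T B \<cdot>\<^bsub>Str \<sigma>\<^esub> TA f = f \<cdot>\<^bsub>Str \<sigma>\<^esub> counit T A"
    using comonad f by (auto simp: comonad_def nat_trans_def identity_functor_def Hom_Str_iff)
  then show ?thesis
    using Hom_Str_comp_fn[OF TA_hom[OF f] x] Hom_Str_comp_fn[OF counit_hom[OF Hom_Str_ends(3)[OF f]] x]
    by metis
qed

lemma comult_nat:
  assumes f: "f \<in> Hom (Str \<sigma>) A B" and x: "x \<in> carrier (TO A)"
  shows "fn (comult T B) (fn (TA f) x) = fn (TA (TA f)) (fn (comult T A) x)"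
proof -
  have "comult T B \<cdot>\<^bsub>Str \<sigma>\<^esub> TA f = TA (TA f) \<cdot>\<^bsub>Str \<sigma>\<^esub> comult T A"
    using comonad f by (auto simp: comonad_def nat_trans_def comp_functor_def Hom_Str_iff)
  then show ?thesis
    using Hom_Str_comp_fn[OF TA_hom[OF f] x] Hom_Str_comp_fn[OF comult_hom[OF Hom_Str_ends(3)[OF f]] x]
    by metis
qed

lemma comonad_laws_fn:
  assumes A: "A \<in> structures \<sigma>" and x: "x \<in> carrier (TO A)"
  shows "fn (counit T (TO A)) (fn (comult T A) x) = x"
    and "fn (TA (counit T A)) (fn (comult T A) x) = x"
    and "fn (comult T (TO A)) (fn (comult T A) x) = fn (TA (comult T A)) (fn (comult T A) x)"
proof -
  have laws: "counit T (TO A) \<cdot>\<^bsub>Str \<sigma>\<^esub> comult T A = Ident (Str \<sigma>) (TO A)"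
    "TA (counit T A) \<cdot>\<^bsub>Str \<sigma>\<^esub> comult T A = Ident (Str \<sigma>) (TO A)"
    "comult T (TO A) \<cdot>\<^bsub>Str \<sigma>\<^esub> comult T A = TA (comult T A) \<cdot>\<^bsub>Str \<sigma>\<^esub> comult T A"
    using comonad A by (auto simp: comonad_def)
  note [simp] = Hom_Str_comp_fn[OF comult_hom[OF A] x, symmetric]
  show "fn (counit T (TO A)) (fn (comult T A) x) = x"
    and "fn (TA (counit T A)) (fn (comult T A) x) = x"
    and "fn (comult T (TO A)) (fn (comult T A) x) = fn (TA (comult T A)) (fn (comult T A) x)"
    using x by (simp_all add: laws)
qed

lemma coalgebras_iff:
  "(A, \<alpha>) \<in> coalgebras (Str \<sigma>) T \<longleftrightarrow> A \<in> structures \<sigma> \<and> \<alpha> \<in> Hom (Str \<sigma>) A (TO A) \<and>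
    (\<forall>x\<in>carrier A. fn (counit T A) (fn \<alpha> x) = x \<and>
      fn (comult T A) (fn \<alpha> x) = fn (TA \<alpha>) (fn \<alpha> x))"
proof (cases "A \<in> structures \<sigma> \<and> \<alpha> \<in> Hom (Str \<sigma>) A (TO A)")
  case True
  then have A: "A \<in> structures \<sigma>" and \<alpha>: "\<alpha> \<in> Hom (Str \<sigma>) A (TO A)" by auto
  note id = Hom_Str_Ident[OF A]
  have "counit T A \<cdot>\<^bsub>Str \<sigma>\<^esub> \<alpha> = Ident (Str \<sigma>) A \<longleftrightarrow> (\<forall>x\<in>carrier A. fn (counit T A) (fn \<alpha> x) = x)"
    by (simp add: Hom_Str_eq_iff[OF Hom_Str_comp[OF \<alpha> counit_hom[OF A]] id] Hom_Str_comp_fn[OF \<alpha>])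
  moreover have "comult T A \<cdot>\<^bsub>Str \<sigma>\<^esub> \<alpha> = TA \<alpha> \<cdot>\<^bsub>Str \<sigma>\<^esub> \<alpha> \<longleftrightarrow>
      (\<forall>x\<in>carrier A. fn (comult T A) (fn \<alpha> x) = fn (TA \<alpha>) (fn \<alpha> x))"
    by (simp add: Hom_Str_eq_iff[OF Hom_Str_comp[OF \<alpha> comult_hom[OF A]] Hom_Str_comp[OF \<alpha> TA_hom[OF \<alpha>]]]
        Hom_Str_comp_fn[OF \<alpha>])
  ultimately show ?thesis
    using True by (auto simp: coalgebras_def)
qed (auto simp: coalgebras_def)

lemma coalgebraD:
  assumes "X \<in> coalgebras (Str \<sigma>) T"
  shows "fst X \<in> structures \<sigma>" "snd X \<in> Hom (Str \<sigma>) (fst X) (TO (fst X))"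
    "x \<in> carrier (fst X) \<Longrightarrow> fn (counit T (fst X)) (fn (snd X) x) = x"
    "x \<in> carrier (fst X) \<Longrightarrow> fn (comult T (fst X)) (fn (snd X) x) = fn (TA (snd X)) (fn (snd X) x)"
  using assms coalgebras_iff[of "fst X" "snd X"] by auto

lemma mors_iff:
  "f \<in> mors X Y \<longleftrightarrow> X \<in> coalgebras (Str \<sigma>) T \<and> Y \<in> coalgebras (Str \<sigma>) T \<and>
    f \<in> Hom (Str \<sigma>) (fst X) (fst Y) \<and>
    (\<forall>x\<in>carrier (fst X). fn (snd Y) (fn f x) = fn (TA f) (fn (snd X) x))"
proof (cases "X \<in> coalgebras (Str \<sigma>) T \<and> Y \<in> coalgebras (Str \<sigma>) T \<and> f \<in> Hom (Str \<sigma>) (fst X) (fst Y)")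
  case True
  then have X: "X \<in> coalgebras (Str \<sigma>) T" and Y: "Y \<in> coalgebras (Str \<sigma>) T"
    and f: "f \<in> Hom (Str \<sigma>) (fst X) (fst Y)" by auto
  have "snd Y \<cdot>\<^bsub>Str \<sigma>\<^esub> f = TA f \<cdot>\<^bsub>Str \<sigma>\<^esub> snd X \<longleftrightarrow>
      (\<forall>x\<in>carrier (fst X). fn (snd Y) (fn f x) = fn (TA f) (fn (snd X) x))"
    by (simp add: Hom_Str_eq_iff[OF Hom_Str_comp[OF f coalgebraD(2)[OF Y]]
          Hom_Str_comp[OF coalgebraD(2)[OF X] TA_hom[OF f]]]
        Hom_Str_comp_fn[OF f] Hom_Str_comp_fn[OF coalgebraD(2)[OF X]])
  then show ?thesis using True by (simp add: EM_def)
qed (auto simp: EM_def)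

lemma morsD:
  assumes "f \<in> mors X Y"
  shows "X \<in> coalgebras (Str \<sigma>) T" "Y \<in> coalgebras (Str \<sigma>) T" "f \<in> Hom (Str \<sigma>) (fst X) (fst Y)"
    "x \<in> carrier (fst X) \<Longrightarrow> fn (snd Y) (fn f x) = fn (TA f) (fn (snd X) x)"
  using assms unfolding mors_iff by auto

lemma mors_comp: "f \<in> mors X Y \<Longrightarrow> g \<in> mors Y Z \<Longrightarrow> g \<cdot>\<^bsub>Str \<sigma>\<^esub> f \<in> mors X Z"
  using category_Hom_comp[OF category_EM[OF category_Str comonad], of "(X, f, Y)" X Y "(Y, g, Z)" Z]
  by (simp add: Hom_def)

section \<open>The universal property of cofree coalgebras\<close>

lemma cofree_coalgebra: "A \<in> structures \<sigma> \<Longrightarrow> cofree T A \<in> coalgebras (Str \<sigma>) T"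
  using comult_hom[of A] comonad_laws_fn(1,3)[of A] Hom_Str_ends(3)[OF comult_hom[of A]]
  by (simp add: cofree_def coalgebras_iff)

text \<open>The transpose of \<open>f\<close> under the adjunction between the forgetful functor and
  \<open>cofree\<close>: the coalgebra morphism from \<open>P\<close> whose composite with the
  counit is \<open>f\<close>.\<close>

definition extend :: "('a, 'r) str_coalg \<Rightarrow> ('a, 'r) morph \<Rightarrow> ('a, 'r) morph" where
  "extend P f = TA f \<cdot>\<^bsub>Str \<sigma>\<^esub> snd P"

lemma extend_fn:
  assumes "P \<in> coalgebras (Str \<sigma>) T" "x \<in> carrier (fst P)"
  shows "fn (extend P f) x = fn (TA f) (fn (snd P) x)"
  unfolding extend_def by (rule Hom_Str_comp_fn[OF coalgebraD(2)[OF assms(1)] assms(2)])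

lemma extend_hom:
  assumes P: "P \<in> coalgebras (Str \<sigma>) T" and f: "f \<in> Hom (Str \<sigma>) (fst P) A"
  shows "extend P f \<in> Hom (Str \<sigma>) (fst P) (TO A)"
  unfolding extend_def by (rule Hom_Str_comp[OF coalgebraD(2)[OF P] TA_hom[OF f]])

lemma extend_mors:
  assumes P: "P \<in> coalgebras (Str \<sigma>) T" and f: "f \<in> Hom (Str \<sigma>) (fst P) A"
  shows "extend P f \<in> mors P (cofree T A)"
  unfolding mors_iff
proof (intro conjI ballI)
  note \<pi> = coalgebraD(2)[OF P]
  show "cofree T A \<in> coalgebras (Str \<sigma>) T" by (rule cofree_coalgebra[OF Hom_Str_ends(4)[OF f]])
  show "extend P f \<in> Hom (Str \<sigma>) (fst P) (fst (cofree T A))"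
    using extend_hom[OF P f] by (simp add: cofree_def)
  fix x assume x: "x \<in> carrier (fst P)"
  have "fn (comult T A) (fn (TA f) (fn (snd P) x)) = fn (TA (TA f)) (fn (comult T (fst P)) (fn (snd P) x))"
    by (rule comult_nat[OF f Hom_Str_maps[OF \<pi> x]])
  also have "\<dots> = fn (TA (TA f)) (fn (TA (snd P)) (fn (snd P) x))"
    using coalgebraD(4)[OF P x] by simp
  also have "\<dots> = fn (TA (extend P f)) (fn (snd P) x)"
    unfolding extend_def using TA_comp_fn[OF \<pi> TA_hom[OF f] Hom_Str_maps[OF \<pi> x]] by simp
  finally show "fn (snd (cofree T A)) (fn (extend P f) x) = fn (TA (extend P f)) (fn (snd P) x)"
    using extend_fn[OF P x] by (simp add: cofree_def)
qed (rule P)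

lemma counit_extend:
  assumes P: "P \<in> coalgebras (Str \<sigma>) T" and f: "f \<in> Hom (Str \<sigma>) (fst P) A" and x: "x \<in> carrier (fst P)"
  shows "fn (counit T A) (fn (extend P f) x) = fn f x"
  using counit_nat[OF f Hom_Str_maps[OF coalgebraD(2)[OF P] x]] coalgebraD(3)[OF P x] extend_fn[OF P x]
  by simp

text \<open>As \<open>q\<close> commutes with the structure maps, \<open>TA q\<close> after the
  structure map of \<open>P\<close> is the comultiplication after \<open>q\<close>, and
  \<open>TA\<close> of the counit cancels the comultiplication.\<close>

lemma extend_unique:
  assumes q: "q \<in> mors P (cofree T A)" and A: "A \<in> structures \<sigma>"
  shows "extend P (counit T A \<cdot>\<^bsub>Str \<sigma>\<^esub> q) = q"
proof -
  note P = morsD(1)[OF q]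
  note \<pi> = coalgebraD(2)[OF P]
  have qh: "q \<in> Hom (Str \<sigma>) (fst P) (TO A)" using morsD(3)[OF q] by (simp add: cofree_def)
  note \<epsilon>q = Hom_Str_comp[OF qh counit_hom[OF A]]
  show ?thesis
  proof (rule Hom_Str_eqI[OF extend_hom[OF P \<epsilon>q] qh])
    fix x assume x: "x \<in> carrier (fst P)"
    have "fn (extend P (counit T A \<cdot>\<^bsub>Str \<sigma>\<^esub> q)) x = fn (TA (counit T A)) (fn (TA q) (fn (snd P) x))"
      using extend_fn[OF P x] TA_comp_fn[OF qh counit_hom[OF A] Hom_Str_maps[OF \<pi> x]] by simp
    also have "\<dots> = fn (TA (counit T A)) (fn (comult T A) (fn q x))"
      using morsD(4)[OF q x] by (simp add: cofree_def)
    also have "\<dots> = fn q x" by (rule comonad_laws_fn(2)[OF A Hom_Str_maps[OF qh x]])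
    finally show "fn (extend P (counit T A \<cdot>\<^bsub>Str \<sigma>\<^esub> q)) x = fn q x" .
  qed
qed

text \<open>The counit separates coalgebra morphisms although it need not be injective: each of them
  is the extension of its composite with the counit.\<close>

lemma mors_cofree_eqI:
  assumes q: "q \<in> mors P (cofree T A)" and q': "q' \<in> mors P (cofree T A)" and A: "A \<in> structures \<sigma>"
    and eq: "\<And>x. x \<in> carrier (fst P) \<Longrightarrow> fn (counit T A) (fn q x) = fn (counit T A) (fn q' x)"
  shows "q = q'"
proof -
  have h: "q \<in> Hom (Str \<sigma>) (fst P) (TO A)" "q' \<in> Hom (Str \<sigma>) (fst P) (TO A)"
    using morsD(3)[OF q] morsD(3)[OF q'] by (simp_all add: cofree_def)
  have "counit T A \<cdot>\<^bsub>Str \<sigma>\<^esub> q = counit T A \<cdot>\<^bsub>Str \<sigma>\<^esub> q'"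
    by (rule Hom_Str_eqI[OF Hom_Str_comp[OF h(1) counit_hom[OF A]] Hom_Str_comp[OF h(2) counit_hom[OF A]]])
       (simp add: Hom_Str_comp_fn[OF h(1)] Hom_Str_comp_fn[OF h(2)] eq)
  then show ?thesis using extend_unique[OF q A] extend_unique[OF q' A] by metis
qed

section \<open>Path embeddings and open pathwise-embeddings on underlying morphisms\<close>

lemma mors_eq: "f \<in> mors X Y \<Longrightarrow> snd Y \<cdot>\<^bsub>Str \<sigma>\<^esub> f = TA f \<cdot>\<^bsub>Str \<sigma>\<^esub> snd X"
  by (simp add: EM_def)

lemma coalg_embeddings_iff:
  "(X, f, Y) \<in> coalg_embeddings \<sigma> T \<longleftrightarrow> f \<in> mors X Y \<and> f \<in> embeddings \<sigma>"
  by (simp add: coalg_embeddings_def)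

lemma path_embedding_iff:
  "path_embedding (EM (Str \<sigma>) T) (coalg_embeddings \<sigma> T) paths (P, e, X) \<longleftrightarrow>
    e \<in> mors P X \<and> e \<in> embeddings \<sigma> \<and> P \<in> paths"
  by (auto simp: path_embedding_def coalg_embeddings_def)

text \<open>Strips the arrows of their ends, so that openness is used and proved by quantifying over
  coalgebras and underlying morphisms separately.\<close>

lemma open_pathwise_embedding_iff:
  assumes f: "f \<in> mors X Y"
  shows "open_pathwise_embedding \<sigma> T paths (X, f, Y) \<longleftrightarrow>
    (\<forall>P Q e m g. P \<in> paths \<longrightarrow> Q \<in> paths \<longrightarrow> e \<in> mors P X \<longrightarrow> e \<in> embeddings \<sigma> \<longrightarrow>
      m \<in> mors Q Y \<longrightarrow> m \<in> embeddings \<sigma> \<longrightarrow> g \<in> mors P Q \<longrightarrow> f \<cdot>\<^bsub>Str \<sigma>\<^esub> e = m \<cdot>\<^bsub>Str \<sigma>\<^esub> g \<longrightarrow>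
      (\<exists>d \<in> mors Q X. e = d \<cdot>\<^bsub>Str \<sigma>\<^esub> g \<and> m = f \<cdot>\<^bsub>Str \<sigma>\<^esub> d)) \<and>
    (\<forall>P e. P \<in> paths \<longrightarrow> e \<in> mors P X \<longrightarrow> e \<in> embeddings \<sigma> \<longrightarrow> f \<cdot>\<^bsub>Str \<sigma>\<^esub> e \<in> embeddings \<sigma>)"
proof -
  have "open_arrow (EM (Str \<sigma>) T) (coalg_embeddings \<sigma> T) paths (X, f, Y) \<longleftrightarrow>
    (\<forall>P Q e m g. P \<in> paths \<longrightarrow> Q \<in> paths \<longrightarrow> e \<in> mors P X \<longrightarrow> e \<in> embeddings \<sigma> \<longrightarrow>
      m \<in> mors Q Y \<longrightarrow> m \<in> embeddings \<sigma> \<longrightarrow> g \<in> mors P Q \<longrightarrow> f \<cdot>\<^bsub>Str \<sigma>\<^esub> e = m \<cdot>\<^bsub>Str \<sigma>\<^esub> g \<longrightarrow>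
      (\<exists>d \<in> mors Q X. e = d \<cdot>\<^bsub>Str \<sigma>\<^esub> g \<and> m = f \<cdot>\<^bsub>Str \<sigma>\<^esub> d))" (is "?L \<longleftrightarrow> ?R")
  proof
    assume L: ?L
    show ?R
    proof (intro allI impI)
      fix P Q e m g
      assume *: "P \<in> paths" "Q \<in> paths" "e \<in> mors P X" "e \<in> embeddings \<sigma>" "m \<in> mors Q Y"
        "m \<in> embeddings \<sigma>" "g \<in> mors P Q" "f \<cdot>\<^bsub>Str \<sigma>\<^esub> e = m \<cdot>\<^bsub>Str \<sigma>\<^esub> g"
      have "\<exists>d \<in> Hom (EM (Str \<sigma>) T) Q X. (P, e, X) = d \<cdot>\<^bsub>EM (Str \<sigma>) T\<^esub> (P, g, Q) \<and>
          (Q, m, Y) = (X, f, Y) \<cdot>\<^bsub>EM (Str \<sigma>) T\<^esub> d"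
        using L * unfolding open_arrow_def
        by (elim conjE allE[where x = "(P, e, X)"] allE[where x = "(Q, m, Y)"] allE[where x = "(P, g, Q)"])
          (simp add: path_embedding_iff Hom_def)
      then show "\<exists>d \<in> mors Q X. e = d \<cdot>\<^bsub>Str \<sigma>\<^esub> g \<and> m = f \<cdot>\<^bsub>Str \<sigma>\<^esub> d"
        by (auto simp: Hom_def)
    qed
  next
    assume R: ?R
    show ?L
      unfolding open_arrow_def
    proof (intro conjI allI impI)
      show "(X, f, Y) \<in> Arr (EM (Str \<sigma>) T)" using f by simp
      fix e m g :: "('a, 'r) str_coalg_arr"
      obtain P e' X' where e: "e = (P, e', X')" by (cases e)
      obtain Q m' Y' where m: "m = (Q, m', Y')" by (cases m)
      obtain P' g' Q' where g: "g = (P', g', Q')" by (cases g)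
      assume "path_embedding (EM (Str \<sigma>) T) (coalg_embeddings \<sigma> T) paths e"
        "Cod (EM (Str \<sigma>) T) e = Dom (EM (Str \<sigma>) T) (X, f, Y)"
        "path_embedding (EM (Str \<sigma>) T) (coalg_embeddings \<sigma> T) paths m"
        "Cod (EM (Str \<sigma>) T) m = Cod (EM (Str \<sigma>) T) (X, f, Y)"
        "g \<in> Hom (EM (Str \<sigma>) T) (Dom (EM (Str \<sigma>) T) e) (Dom (EM (Str \<sigma>) T) m)"
        "(X, f, Y) \<cdot>\<^bsub>EM (Str \<sigma>) T\<^esub> e = m \<cdot>\<^bsub>EM (Str \<sigma>) T\<^esub> g"
      then have *: "X' = X" "Y' = Y" "P' = P" "Q' = Q" "P \<in> paths" "Q \<in> paths" "e' \<in> mors P X"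
        "e' \<in> embeddings \<sigma>" "m' \<in> mors Q Y" "m' \<in> embeddings \<sigma>" "g' \<in> mors P Q"
        "f \<cdot>\<^bsub>Str \<sigma>\<^esub> e' = m' \<cdot>\<^bsub>Str \<sigma>\<^esub> g'"
        by (auto simp: e m g path_embedding_iff Hom_def)
      obtain d where "d \<in> mors Q X" "e' = d \<cdot>\<^bsub>Str \<sigma>\<^esub> g'" "m' = f \<cdot>\<^bsub>Str \<sigma>\<^esub> d"
        using R[rule_format, OF *(5-12)] by blast
      then show "\<exists>d\<in>Hom (EM (Str \<sigma>) T) (Dom (EM (Str \<sigma>) T) m) (Dom (EM (Str \<sigma>) T) (X, f, Y)).
          e = d \<cdot>\<^bsub>EM (Str \<sigma>) T\<^esub> g \<and> m = (X, f, Y) \<cdot>\<^bsub>EM (Str \<sigma>) T\<^esub> d"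
        using *(1-4) by (intro bexI[where x = "(Q, d, X)"]) (simp_all add: e m g Hom_def)
    qed
  qed
  moreover have "pathwise_embedding (EM (Str \<sigma>) T) (coalg_embeddings \<sigma> T) paths (X, f, Y) \<longleftrightarrow>
    (\<forall>P e. P \<in> paths \<longrightarrow> e \<in> mors P X \<longrightarrow> e \<in> embeddings \<sigma> \<longrightarrow> f \<cdot>\<^bsub>Str \<sigma>\<^esub> e \<in> embeddings \<sigma>)"
  proof -
    have all: "(\<forall>e. R e) \<longleftrightarrow> (\<forall>P e' Z. R (P, e', Z))" for R :: "('a, 'r) str_coalg_arr \<Rightarrow> bool"
      by (metis prod_cases3)
    show ?thesis
      unfolding pathwise_embedding_def all path_embedding_iff EM_sel coalg_embeddings_iff
      using f mors_comp[OF _ f] by (auto simp del: split_paired_All)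
  qed
  ultimately show ?thesis by (simp only: open_pathwise_embedding_def)
qed

end

section \<open>Subcoalgebras under a comonad that preserves embeddings\<close>

locale embedding_comonad = str_comonad +
  assumes TA_embedding: "comonad_preserves_embeddings \<sigma> T"
begin

lemma TA_emb: "f \<in> embeddings \<sigma> \<Longrightarrow> TA f \<in> embeddings \<sigma>"
  using TA_embedding by (simp add: comonad_preserves_embeddings_def)

text \<open>\<open>TA m\<close> is an embedding, so the structure map of \<open>Y\<close> restricts
  to \<open>S\<close> as soon as its values lie in the image of \<open>TA m\<close>. The two
  coalgebra laws for the restriction hold after \<open>m\<close> and after \<open>TA (TA m)\<close>
  respectively, and both of these are injective.\<close>

lemma subcoalgebra:
  assumes Y: "Y \<in> coalgebras (Str \<sigma>) T"
    and m: "m \<in> embeddings \<sigma>" "m \<in> Hom (Str \<sigma>) S (fst Y)"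
    and closed: "\<And>x. x \<in> carrier S \<Longrightarrow> fn (snd Y) (fn m x) \<in> fn (TA m) ` carrier (TO S)"
  obtains \<gamma> where "(S, \<gamma>) \<in> coalgebras (Str \<sigma>) T" "m \<in> mors (S, \<gamma>) Y"
proof -
  note S = Hom_Str_ends(3)[OF m(2)]
  note \<upsilon> = coalgebraD(2)[OF Y]
  have "fn (snd Y \<cdot>\<^bsub>Str \<sigma>\<^esub> m) x \<in> fn (TA m) ` carrier (TO S)" if "x \<in> carrier S" for x
    using closed[OF that] Hom_Str_comp_fn[OF m(2) that] by simp
  then obtain \<gamma> where \<gamma>: "\<gamma> \<in> Hom (Str \<sigma>) S (TO S)" and eq: "TA m \<cdot>\<^bsub>Str \<sigma>\<^esub> \<gamma> = snd Y \<cdot>\<^bsub>Str \<sigma>\<^esub> m"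
    by (rule embedding_factor[OF TA_emb[OF m(1)] TA_hom[OF m(2)] Hom_Str_comp[OF m(2) \<upsilon>]])
  have eq_fn: "fn (TA m) (fn \<gamma> x) = fn (snd Y) (fn m x)" if "x \<in> carrier S" for x
    using eq Hom_Str_comp_fn[OF m(2) that] Hom_Str_comp_fn[OF \<gamma> that] by metis
  have coalg: "(S, \<gamma>) \<in> coalgebras (Str \<sigma>) T"
    unfolding coalgebras_iff
  proof (intro conjI ballI)
    fix x assume x: "x \<in> carrier S"
    note mx = Hom_Str_maps[OF m(2) x] and \<gamma>x = Hom_Str_maps[OF \<gamma> x]
    have "fn m (fn (counit T S) (fn \<gamma> x)) = fn (counit T (fst Y)) (fn (TA m) (fn \<gamma> x))"
      using counit_nat[OF m(2) \<gamma>x] by simp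
    also have "\<dots> = fn m x"
      using eq_fn[OF x] coalgebraD(3)[OF Y mx] by simp
    finally show "fn (counit T S) (fn \<gamma> x) = x"
      by (rule embedding_inj[OF m Hom_Str_maps[OF counit_hom[OF S] \<gamma>x] x])
    have "fn (TA (TA m)) (fn (comult T S) (fn \<gamma> x)) = fn (comult T (fst Y)) (fn (TA m) (fn \<gamma> x))"
      using comult_nat[OF m(2) \<gamma>x] by simp
    also have "\<dots> = fn (TA (snd Y)) (fn (TA m) (fn \<gamma> x))"
      using eq_fn[OF x] coalgebraD(4)[OF Y mx] by simp
    also have "\<dots> = fn (TA (TA m \<cdot>\<^bsub>Str \<sigma>\<^esub> \<gamma>)) (fn \<gamma> x)"
      unfolding eq using TA_comp_fn[OF m(2) \<upsilon> \<gamma>x] by simp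
    also have "\<dots> = fn (TA (TA m)) (fn (TA \<gamma>) (fn \<gamma> x))"
      using TA_comp_fn[OF \<gamma> TA_hom[OF m(2)] \<gamma>x] by simp
    finally show "fn (comult T S) (fn \<gamma> x) = fn (TA \<gamma>) (fn \<gamma> x)"
      by (rule embedding_inj[OF TA_emb[OF TA_emb[OF m(1)]] TA_hom[OF TA_hom[OF m(2)]]
            Hom_Str_maps[OF comult_hom[OF S] \<gamma>x] Hom_Str_maps[OF TA_hom[OF \<gamma>] \<gamma>x]])
  qed (fact S \<gamma>)+
  moreover have "m \<in> mors (S, \<gamma>) Y"
    unfolding mors_iff using coalg Y m eq_fn by simp
  ultimately show ?thesis using that by blast
qed

text \<open>The factor of the underlying map commutes with the structure maps because it does so
  after the injective map \<open>TA m\<close>.\<close>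

lemma mors_factor:
  assumes m: "m \<in> embeddings \<sigma>" "m \<in> mors K Y" and h: "h \<in> mors Z Y"
    and image: "\<And>x. x \<in> carrier (fst Z) \<Longrightarrow> fn h x \<in> fn m ` carrier (fst K)"
  obtains k where "k \<in> mors Z K" "m \<cdot>\<^bsub>Str \<sigma>\<^esub> k = h"
proof -
  note mh = morsD(3)[OF m(2)]
  note \<zeta> = coalgebraD(2)[OF morsD(1)[OF h]] and \<gamma> = coalgebraD(2)[OF morsD(1)[OF m(2)]]
  obtain k where k: "k \<in> Hom (Str \<sigma>) (fst Z) (fst K)" and mk: "m \<cdot>\<^bsub>Str \<sigma>\<^esub> k = h"
    by (rule embedding_factor[OF m(1) mh morsD(3)[OF h] image])
  have "fn (snd K) (fn k x) = fn (TA k) (fn (snd Z) x)" if x: "x \<in> carrier (fst Z)" for x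
  proof -
    note kx = Hom_Str_maps[OF k x] and \<zeta>x = Hom_Str_maps[OF \<zeta> x]
    have "fn (TA m) (fn (snd K) (fn k x)) = fn (snd Y) (fn h x)"
      using morsD(4)[OF m(2) kx] mk Hom_Str_comp_fn[OF k x] by metis
    also have "\<dots> = fn (TA m) (fn (TA k) (fn (snd Z) x))"
      using morsD(4)[OF h x] TA_comp_fn[OF k mh \<zeta>x] mk by simp
    finally show ?thesis
      by (rule embedding_inj[OF TA_emb[OF m(1)] TA_hom[OF mh]
            Hom_Str_maps[OF \<gamma> kx] Hom_Str_maps[OF TA_hom[OF k] \<zeta>x]])
  qed
  then have "k \<in> mors Z K"
    unfolding mors_iff using k morsD(1)[OF h] morsD(1)[OF m(2)] by simp
  then show ?thesis using mk that by blast
qed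

text \<open>The largest subcoalgebra is the union of all subsets \<open>S\<close> of \<open>E\<close> that the structure map sends
  into the image of \<open>T S\<close>. The point is adjoined so that the union is a pointed structure even if
  there is no such \<open>S\<close>.\<close>

lemma largest_subcoalgebra:
  assumes Y: "Y \<in> coalgebras (Str \<sigma>) T"
    and E: "set_option (point (fst Y)) \<subseteq> E"
  obtains K m where "m \<in> mors K Y" "m \<in> embeddings \<sigma>"
    "\<And>x. x \<in> carrier (fst K) \<Longrightarrow> fn m x \<in> E"
    "\<And>Z h. h \<in> mors Z Y \<Longrightarrow> (\<And>x. x \<in> carrier (fst Z) \<Longrightarrow> fn h x \<in> E) \<Longrightarrow>
      \<exists>k. k \<in> mors Z K \<and> m \<cdot>\<^bsub>Str \<sigma>\<^esub> k = h"
proof -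
  let ?A = "fst Y" and ?\<upsilon> = "snd Y"
  note A = coalgebraD(1)[OF Y] and \<upsilon> = coalgebraD(2)[OF Y]
  define closed where "closed S \<longleftrightarrow> S \<subseteq> carrier ?A \<and> set_option (point ?A) \<subseteq> S \<and>
    (\<forall>x\<in>S. fn ?\<upsilon> x \<in> fn (TA (inclusion ?A S)) ` carrier (TO (substructure ?A S)))" for S
  define G where "G = set_option (point ?A) \<union> \<Union>{S. S \<subseteq> E \<and> closed S}"
  let ?m = "inclusion ?A G"
  have GA: "G \<subseteq> carrier ?A" "set_option (point ?A) \<subseteq> G"
    using structures_point[OF A] by (auto simp: G_def closed_def)
  note m = inclusion_embedding[OF A GA]
  have closedG: "fn ?\<upsilon> x \<in> fn (TA ?m) ` carrier (TO (substructure ?A G))" if x: "x \<in> G" for x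
  proof (cases "point ?A = Some x")
    \<comment> \<open>The point is treated directly: \<open>?\<upsilon>\<close> and
      \<open>TA ?m\<close> are homomorphisms, so both reach the point of
      \<open>TO ?A\<close>.\<close>
    case True
    then have "point (TO ?A) = Some (fn ?\<upsilon> x)"
      using Hom_Str_point[OF \<upsilon>] by simp
    then obtain z where z: "point (TO (substructure ?A G)) = Some z" "fn (TA ?m) z = fn ?\<upsilon> x"
      using Hom_Str_point[OF TA_hom[OF m(1)]] by auto
    then show ?thesis
      using structures_point[OF Hom_Str_ends(3)[OF TA_hom[OF m(1)]] z(1)] by force
  next
    case False
    then obtain S where S: "S \<subseteq> E" "closed S" "x \<in> S"
      using x by (auto simp: G_def)
    then have SA: "S \<subseteq> carrier ?A" "set_option (point ?A) \<subseteq> S" and SG: "S \<subseteq> G"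
      by (auto simp: G_def closed_def)
    note i = inclusion_embedding[OF A SA]
    obtain z where z: "z \<in> carrier (TO (substructure ?A S))" "fn ?\<upsilon> x = fn (TA (inclusion ?A S)) z"
      using S by (auto simp: closed_def)
    \<comment> \<open>Being closed passes to the union because the inclusion of \<open>S\<close>
      factors through that of \<open>G\<close>, and \<open>TA j\<close> moves the witness
      \<open>z\<close> along.\<close>
    have "fn (inclusion ?A S) x \<in> fn ?m ` carrier (substructure ?A G)"
      if "x \<in> carrier (substructure ?A S)" for x
      using that SG by (auto intro!: image_eqI[where x = x])
    then obtain j where j: "j \<in> Hom (Str \<sigma>) (substructure ?A S) (substructure ?A G)"
      and mj: "?m \<cdot>\<^bsub>Str \<sigma>\<^esub> j = inclusion ?A S"
      by (rule embedding_factor[OF m(2,1) i(1)])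
    have "fn ?\<upsilon> x = fn (TA ?m) (fn (TA j) z)"
      using z(2) TA_comp_fn[OF j m(1) z(1)] mj by simp
    then show ?thesis using Hom_Str_maps[OF TA_hom[OF j] z(1)] by blast
  qed
  then have "fn ?\<upsilon> (fn ?m x) \<in> fn (TA ?m) ` carrier (TO (substructure ?A G))"
    if "x \<in> carrier (substructure ?A G)" for x
    using that by simp
  then obtain \<gamma> where m_mor: "?m \<in> mors (substructure ?A G, \<gamma>) Y"
    by (rule subcoalgebra[OF Y m(2,1)])
  show ?thesis
  proof (rule that[OF m_mor m(2)])
    fix x assume "x \<in> carrier (fst (substructure ?A G, \<gamma>))"
    then show "fn ?m x \<in> E" using E by (auto simp: G_def)
  next
    fix Z h assume h: "h \<in> mors Z Y" and hE: "\<And>x. x \<in> carrier (fst Z) \<Longrightarrow> fn h x \<in> E"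
    note hh = morsD(3)[OF h] and \<zeta> = coalgebraD(2)[OF morsD(1)[OF h]]
    \<comment> \<open>The image of \<open>h\<close> is one of the sets whose union is
      \<open>G\<close>. It is closed because \<open>?\<upsilon>\<close> after \<open>h\<close> is
      \<open>TA h\<close> after the structure map of \<open>Z\<close>, and \<open>TA h\<close>
      factors through \<open>TA\<close> of the inclusion of the image.\<close>
    let ?S = "fn h ` carrier (fst Z)"
    have SA: "?S \<subseteq> carrier ?A" using Hom_Str_maps[OF hh] by auto
    have pt: "set_option (point ?A) \<subseteq> ?S"
    proof
      fix a assume "a \<in> set_option (point ?A)"
      then obtain z where "point (fst Z) = Some z" "fn h z = a"
        using Hom_Str_point[OF hh] by auto
      then show "a \<in> ?S" using structures_point[OF Hom_Str_ends(3)[OF hh]] by blast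
    qed
    note i = inclusion_embedding[OF A SA pt]
    obtain k where k: "k \<in> Hom (Str \<sigma>) (fst Z) (substructure ?A ?S)"
      and ik: "inclusion ?A ?S \<cdot>\<^bsub>Str \<sigma>\<^esub> k = h"
      by (rule embedding_factor[OF i(2,1) hh]) (auto simp: image_iff)
    have "fn ?\<upsilon> (fn h x) \<in> fn (TA (inclusion ?A ?S)) ` carrier (TO (substructure ?A ?S))"
      if x: "x \<in> carrier (fst Z)" for x
    proof -
      note \<zeta>x = Hom_Str_maps[OF \<zeta> x]
      have "fn ?\<upsilon> (fn h x) = fn (TA (inclusion ?A ?S)) (fn (TA k) (fn (snd Z) x))"
        using morsD(4)[OF h x] TA_comp_fn[OF k i(1) \<zeta>x] ik by simp
      then show ?thesis using Hom_Str_maps[OF TA_hom[OF k] \<zeta>x] by blast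
    qed
    then have "closed ?S" using SA pt by (auto simp: closed_def)
    moreover have "?S \<subseteq> E" using hE by auto
    ultimately have "?S \<subseteq> G" by (auto simp: G_def)
    then have image: "fn h x \<in> fn ?m ` carrier (fst (substructure ?A G, \<gamma>))" if "x \<in> carrier (fst Z)" for x
      using subsetD[OF _ imageI[OF that], of "fn h" G] by (auto intro!: image_eqI[where x = "fn h x"])
    obtain k where "k \<in> mors Z (substructure ?A G, \<gamma>)" "?m \<cdot>\<^bsub>Str \<sigma>\<^esub> k = h"
      by (rule mors_factor[OF m(2) m_mor h image])
    then show "\<exists>k. k \<in> mors Z (substructure ?A G, \<gamma>) \<and> ?m \<cdot>\<^bsub>Str \<sigma>\<^esub> k = h"
      by (intro exI conjI)
  qed
qed

end


section \<open>Lifting a functor along a Kleisli law\<close>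

locale kleisli_lifting = D: embedding_comonad \<tau> \<DD>
  for \<tau> :: "'s signature" and \<DD> :: "('b, 's) str_comonad" +
  fixes \<sigma> :: "'i \<Rightarrow> 'r signature" and \<CC> :: "'i \<Rightarrow> ('a, 'r) str_comonad"
    and H :: "('i, 'a, 'r, 'b, 's) str_functor" and \<kappa> :: "('i \<Rightarrow> ('a, 'r) struc) \<Rightarrow> ('b, 's) morph"
  assumes comonads: "\<And>i. comonad (Str (\<sigma> i)) (\<CC> i)"
    and functor_H: "is_functor (product_category (\<lambda>i. Str (\<sigma> i))) (Str \<tau>) H"
    and H_embedding: "functor_preserves_embeddings \<sigma> \<tau> H"
    and kleisli: "kleisli_law (\<lambda>i. Str (\<sigma> i)) (Str \<tau>) \<CC> \<DD> H \<kappa>"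
begin

sublocale C: str_comonad "\<sigma> i" "\<CC> i" for i
  by unfold_locales (rule comonads)

lemma product_arrow_iff:
  "f \<in> Hom (product_category (\<lambda>i. Str (\<sigma> i))) A B \<longleftrightarrow> (\<forall>i. f i \<in> Hom (Str (\<sigma> i)) (A i) (B i))"
  by (auto simp: product_category_def Hom_def)

lemma H_hom:
  assumes "\<And>i. f i \<in> Hom (Str (\<sigma> i)) (A i) (B i)"
  shows "ar H f \<in> Hom (Str \<tau>) (ob H A) (ob H B)"
proof -
  have "f \<in> Hom (product_category (\<lambda>i. Str (\<sigma> i))) A B"
    using assms by (simp add: product_arrow_iff)
  then show ?thesis using functor_H by (auto simp: is_functor_def Hom_def)
qed

lemma H_ob: "(\<And>i. A i \<in> structures (\<sigma> i)) \<Longrightarrow> ob H A \<in> structures \<tau>"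
  using functor_H by (simp add: is_functor_def product_category_def)

lemma H_comp:
  assumes "\<And>i. f i \<in> Hom (Str (\<sigma> i)) (A i) (B i)" "\<And>i. g i \<in> Hom (Str (\<sigma> i)) (B i) (C i)"
  shows "ar H (\<lambda>i. g i \<cdot>\<^bsub>Str (\<sigma> i)\<^esub> f i) = ar H g \<cdot>\<^bsub>Str \<tau>\<^esub> ar H f"
proof -
  have "(\<forall>i. f i \<in> homomorphisms (\<sigma> i)) \<and> (\<forall>i. g i \<in> homomorphisms (\<sigma> i)) \<and>
      (\<lambda>i. tgt (f i)) = (\<lambda>i. src (g i))"
    using assms by (simp add: Hom_Str_iff)
  then show ?thesis
    using functor_H unfolding is_functor_def product_category_def by simp
qed

lemma H_comp_fn:
  assumes "\<And>i. f i \<in> Hom (Str (\<sigma> i)) (A i) (B i)" "\<And>i. g i \<in> Hom (Str (\<sigma> i)) (B i) (C i)"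
    and "x \<in> carrier (ob H A)"
  shows "fn (ar H (\<lambda>i. g i \<cdot>\<^bsub>Str (\<sigma> i)\<^esub> f i)) x = fn (ar H g) (fn (ar H f) x)"
  using H_comp[OF assms(1,2)] Hom_Str_comp_fn[OF H_hom[OF assms(1)] assms(3)] by simp

lemma H_emb: "(\<And>i. f i \<in> embeddings (\<sigma> i)) \<Longrightarrow> ar H f \<in> embeddings \<tau>"
  using H_embedding by (simp add: functor_preserves_embeddings_def)

lemma kappa_hom:
  assumes "\<And>i. A i \<in> structures (\<sigma> i)"
  shows "\<kappa> A \<in> Hom (Str \<tau>) (D.TO (ob H A)) (ob H (\<lambda>i. C.TO i (A i)))"
  using kleisli assms
  by (simp add: kleisli_law_def nat_trans_def comp_functor_def product_functor_def product_category_def)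

lemma kappa_nat:
  assumes f: "\<And>i. f i \<in> Hom (Str (\<sigma> i)) (A i) (B i)" and x: "x \<in> carrier (D.TO (ob H A))"
  shows "fn (\<kappa> B) (fn (D.TA (ar H f)) x) = fn (ar H (\<lambda>i. C.TA i (f i))) (fn (\<kappa> A) x)"
proof -
  have AB: "A = (\<lambda>i. src (f i))" "B = (\<lambda>i. tgt (f i))" and "\<And>i. f i \<in> homomorphisms (\<sigma> i)"
    using f by (auto simp: Hom_Str_iff)
  then have "\<kappa> B \<cdot>\<^bsub>Str \<tau>\<^esub> D.TA (ar H f) = ar H (\<lambda>i. C.TA i (f i)) \<cdot>\<^bsub>Str \<tau>\<^esub> \<kappa> A"
    using kleisli
    by (simp add: kleisli_law_def nat_trans_def comp_functor_def product_functor_def product_category_def)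
  then show ?thesis
    using Hom_Str_comp_fn[OF D.TA_hom[OF H_hom[OF f]] x, of "\<kappa> B"]
      Hom_Str_comp_fn[OF kappa_hom[OF Hom_Str_ends(3)[OF f]] x, of "ar H (\<lambda>i. C.TA i (f i))"]
    by simp
qed

lemma kappa_counit:
  assumes A: "\<And>i. A i \<in> structures (\<sigma> i)" and x: "x \<in> carrier (D.TO (ob H A))"
  shows "fn (ar H (\<lambda>i. counit (\<CC> i) (A i))) (fn (\<kappa> A) x) = fn (counit \<DD> (ob H A)) x"
proof -
  have "ar H (\<lambda>i. counit (\<CC> i) (A i)) \<cdot>\<^bsub>Str \<tau>\<^esub> \<kappa> A = counit \<DD> (ob H A)"
    using kleisli A by (simp add: kleisli_law_def product_category_def)
  then show ?thesis using Hom_Str_comp_fn[OF kappa_hom[OF A] x] by metis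
qed

lemma kappa_comult:
  assumes A: "\<And>i. A i \<in> structures (\<sigma> i)" and x: "x \<in> carrier (D.TO (ob H A))"
  shows "fn (\<kappa> (\<lambda>i. C.TO i (A i))) (fn (D.TA (\<kappa> A)) (fn (comult \<DD> (ob H A)) x)) =
    fn (ar H (\<lambda>i. comult (\<CC> i) (A i))) (fn (\<kappa> A) x)"
proof -
  have eq: "\<kappa> (\<lambda>i. C.TO i (A i)) \<cdot>\<^bsub>Str \<tau>\<^esub> D.TA (\<kappa> A) \<cdot>\<^bsub>Str \<tau>\<^esub> comult \<DD> (ob H A) =
      ar H (\<lambda>i. comult (\<CC> i) (A i)) \<cdot>\<^bsub>Str \<tau>\<^esub> \<kappa> A"
    using kleisli A by (simp add: kleisli_law_def product_category_def)
  note \<delta> = D.comult_hom[OF H_ob[OF A]] and \<kappa>A = kappa_hom[OF A]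
  have "fn (\<kappa> (\<lambda>i. C.TO i (A i)) \<cdot>\<^bsub>Str \<tau>\<^esub> D.TA (\<kappa> A) \<cdot>\<^bsub>Str \<tau>\<^esub> comult \<DD> (ob H A)) x =
      fn (\<kappa> (\<lambda>i. C.TO i (A i))) (fn (D.TA (\<kappa> A)) (fn (comult \<DD> (ob H A)) x))"
    using Hom_Str_comp_fn[OF Hom_Str_comp[OF \<delta> D.TA_hom[OF \<kappa>A]] x] Hom_Str_comp_fn[OF \<delta> x] by simp
  then show ?thesis using eq Hom_Str_comp_fn[OF \<kappa>A x] by simp
qed

section \<open>Arrows compatible with the Kleisli law\<close>

abbreviation compat :: "('b, 's) str_coalg \<Rightarrow> ('i \<Rightarrow> ('a, 'r) str_coalg) \<Rightarrow> ('b, 's) morph set" where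
  "compat \<equiv> compatible (Str \<tau>) \<DD> H \<kappa>"

lemma compat_iff:
  assumes P: "P \<in> coalgebras (Str \<tau>) \<DD>" and X: "\<And>i. X i \<in> coalgebras (Str (\<sigma> i)) (\<CC> i)"
  shows "f \<in> compat P X \<longleftrightarrow> f \<in> Hom (Str \<tau>) (fst P) (ob H (\<lambda>i. fst (X i))) \<and>
    (\<forall>x\<in>carrier (fst P). fn (ar H (\<lambda>i. snd (X i))) (fn f x) =
      fn (\<kappa> (\<lambda>i. fst (X i))) (fn (D.TA f) (fn (snd P) x)))"
proof (cases "f \<in> Hom (Str \<tau>) (fst P) (ob H (\<lambda>i. fst (X i)))")
  case f: True
  note \<pi> = D.coalgebraD(2)[OF P]
  have \<alpha>: "ar H (\<lambda>i. snd (X i)) \<in> Hom (Str \<tau>) (ob H (\<lambda>i. fst (X i))) (ob H (\<lambda>i. C.TO i (fst (X i))))"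
    by (rule H_hom) (rule C.coalgebraD(2)[OF X])
  have \<kappa>: "\<kappa> (\<lambda>i. fst (X i)) \<in> Hom (Str \<tau>) (D.TO (ob H (\<lambda>i. fst (X i)))) (ob H (\<lambda>i. C.TO i (fst (X i))))"
    by (rule kappa_hom) (rule C.coalgebraD(1)[OF X])
  show ?thesis
    using f by (simp add: compatible_def
      Hom_Str_eq_iff[OF Hom_Str_comp[OF f \<alpha>] Hom_Str_comp[OF Hom_Str_comp[OF \<pi> D.TA_hom[OF f]] \<kappa>]]
      Hom_Str_comp_fn[OF f] Hom_Str_comp_fn[OF Hom_Str_comp[OF \<pi> D.TA_hom[OF f]]] Hom_Str_comp_fn[OF \<pi>])
qed (simp add: compatible_def)

lemma compat_hom: "f \<in> compat P X \<Longrightarrow> f \<in> Hom (Str \<tau>) (fst P) (ob H (\<lambda>i. fst (X i)))"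
  by (simp add: compatible_def)

text \<open>Contravariant functoriality in the coalgebra. \<open>H_comp_compat\<close> is the
  covariant counterpart in \<open>X\<close>, so \<open>compat\<close> has the two-sided action
  expected of a hom-set.\<close>

lemma compat_comp_mors:
  assumes g: "g \<in> D.mors P Q" and f: "f \<in> compat Q X"
    and X: "\<And>i. X i \<in> coalgebras (Str (\<sigma> i)) (\<CC> i)"
  shows "f \<cdot>\<^bsub>Str \<tau>\<^esub> g \<in> compat P X"
proof -
  note P = D.morsD(1)[OF g] and Q = D.morsD(2)[OF g] and gh = D.morsD(3)[OF g] and fh = compat_hom[OF f]
  note \<pi> = D.coalgebraD(2)[OF P]
  have "fn (ar H (\<lambda>i. snd (X i))) (fn (f \<cdot>\<^bsub>Str \<tau>\<^esub> g) x) =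
      fn (\<kappa> (\<lambda>i. fst (X i))) (fn (D.TA (f \<cdot>\<^bsub>Str \<tau>\<^esub> g)) (fn (snd P) x))"
    if x: "x \<in> carrier (fst P)" for x
  proof -
    have "fn (ar H (\<lambda>i. snd (X i))) (fn f (fn g x)) =
        fn (\<kappa> (\<lambda>i. fst (X i))) (fn (D.TA f) (fn (snd Q) (fn g x)))"
      using f Hom_Str_maps[OF gh x] unfolding compat_iff[OF Q X] by blast
    then show ?thesis
      using D.morsD(4)[OF g x] D.TA_comp_fn[OF gh fh Hom_Str_maps[OF \<pi> x]] Hom_Str_comp_fn[OF gh x]
      by simp
  qed
  then show ?thesis
    unfolding compat_iff[OF P X] using Hom_Str_comp[OF gh fh] by blast
qed

text \<open>The \<open>d i\<close> commute with the structure maps, which produces \<open>H\<close>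
  of the \<open>C.TA i (d i)\<close>; naturality of \<kappa> then exchanges this for
  \<open>D.TA (ar H d)\<close>.\<close>

lemma H_comp_compat:
  assumes d: "\<And>i. d i \<in> C.mors i (X i) (Y i)" and f: "f \<in> compat P X"
    and P: "P \<in> coalgebras (Str \<tau>) \<DD>"
  shows "ar H d \<cdot>\<^bsub>Str \<tau>\<^esub> f \<in> compat P Y"
proof -
  note X = C.morsD(1)[OF d] and Y = C.morsD(2)[OF d] and dh = C.morsD(3)[OF d] and fh = compat_hom[OF f]
  note \<pi> = D.coalgebraD(2)[OF P]
  have Hd: "ar H d \<in> Hom (Str \<tau>) (ob H (\<lambda>i. fst (X i))) (ob H (\<lambda>i. fst (Y i)))"
    by (rule H_hom[OF dh])
  have "fn (ar H (\<lambda>i. snd (Y i))) (fn (ar H d \<cdot>\<^bsub>Str \<tau>\<^esub> f) x) =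
      fn (\<kappa> (\<lambda>i. fst (Y i))) (fn (D.TA (ar H d \<cdot>\<^bsub>Str \<tau>\<^esub> f)) (fn (snd P) x))"
    if x: "x \<in> carrier (fst P)" for x
  proof -
    note fx = Hom_Str_maps[OF fh x] and \<pi>x = Hom_Str_maps[OF \<pi> x]
    have "fn (ar H (\<lambda>i. snd (Y i))) (fn (ar H d) (fn f x)) =
        fn (ar H (\<lambda>i. snd (Y i) \<cdot>\<^bsub>Str (\<sigma> i)\<^esub> d i)) (fn f x)"
      by (rule H_comp_fn[OF dh C.coalgebraD(2)[OF Y] fx, symmetric])
    also have "\<dots> = fn (ar H (\<lambda>i. C.TA i (d i) \<cdot>\<^bsub>Str (\<sigma> i)\<^esub> snd (X i))) (fn f x)"
      using C.mors_eq[OF d] by simp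
    also have "\<dots> = fn (ar H (\<lambda>i. C.TA i (d i))) (fn (ar H (\<lambda>i. snd (X i))) (fn f x))"
      by (rule H_comp_fn[OF C.coalgebraD(2)[OF X] C.TA_hom[OF dh] fx])
    also have "\<dots> = fn (ar H (\<lambda>i. C.TA i (d i))) (fn (\<kappa> (\<lambda>i. fst (X i))) (fn (D.TA f) (fn (snd P) x)))"
      using f x unfolding compat_iff[OF P X] by simp
    also have "\<dots> = fn (\<kappa> (\<lambda>i. fst (Y i))) (fn (D.TA (ar H d)) (fn (D.TA f) (fn (snd P) x)))"
      by (rule kappa_nat[OF dh Hom_Str_maps[OF D.TA_hom[OF fh] \<pi>x], symmetric])
    finally show ?thesis
      using D.TA_comp_fn[OF fh Hd \<pi>x] Hom_Str_comp_fn[OF fh x] by simp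
  qed
  then show ?thesis
    unfolding compat_iff[OF P Y] using Hom_Str_comp[OF fh Hd] by blast
qed

text \<open>This is where the law relating \<kappa> to the comultiplications enters: for cofree
  coalgebras, compatibility of \<open>\<kappa> A\<close> after \<open>r\<close> is that law composed
  with \<open>r\<close>.\<close>

lemma kappa_comp_compat:
  assumes r: "r \<in> D.mors Q (cofree \<DD> (ob H A))" and A: "\<And>i. A i \<in> structures (\<sigma> i)"
  shows "\<kappa> A \<cdot>\<^bsub>Str \<tau>\<^esub> r \<in> compat Q (\<lambda>i. cofree (\<CC> i) (A i))"
proof -
  note Q = D.morsD(1)[OF r]
  note \<rho> = D.coalgebraD(2)[OF Q] and \<kappa>A = kappa_hom[OF A]
  have rh: "r \<in> Hom (Str \<tau>) (fst Q) (D.TO (ob H A))"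
    using D.morsD(3)[OF r] by (simp add: cofree_def)
  have "fn (ar H (\<lambda>i. comult (\<CC> i) (A i))) (fn (\<kappa> A \<cdot>\<^bsub>Str \<tau>\<^esub> r) x) =
      fn (\<kappa> (\<lambda>i. C.TO i (A i))) (fn (D.TA (\<kappa> A \<cdot>\<^bsub>Str \<tau>\<^esub> r)) (fn (snd Q) x))"
    if x: "x \<in> carrier (fst Q)" for x
  proof -
    have "fn (ar H (\<lambda>i. comult (\<CC> i) (A i))) (fn (\<kappa> A) (fn r x)) =
        fn (\<kappa> (\<lambda>i. C.TO i (A i))) (fn (D.TA (\<kappa> A)) (fn (comult \<DD> (ob H A)) (fn r x)))"
      by (rule kappa_comult[OF A Hom_Str_maps[OF rh x], symmetric])
    also have "fn (comult \<DD> (ob H A)) (fn r x) = fn (D.TA r) (fn (snd Q) x)"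
      using D.morsD(4)[OF r x] by (simp add: cofree_def)
    finally show ?thesis
      using D.TA_comp_fn[OF rh \<kappa>A Hom_Str_maps[OF \<rho> x]] Hom_Str_comp_fn[OF rh x] by simp
  qed
  then show ?thesis
    unfolding compat_iff[OF Q C.cofree_coalgebra[OF A]] using Hom_Str_comp[OF rh \<kappa>A]
    by (simp add: cofree_def)
qed

text \<open>Naturality of \<kappa> at the counits and compatibility of \<open>w\<close> reduce the
  left side to \<open>H\<close> of \<open>C.TA i\<close> of the counit after the comultiplication,
  which is an identity. Hence composition with \<open>\<kappa> A\<close> is onto the compatible
  arrows into cofree coalgebras, with inverse given by extending the composite with the
  counits.\<close>

lemma compat_cofree_eq:
  assumes w: "w \<in> compat P (\<lambda>i. cofree (\<CC> i) (A i))" and P: "P \<in> coalgebras (Str \<tau>) \<DD>"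
    and A: "\<And>i. A i \<in> structures (\<sigma> i)"
  shows "\<kappa> A \<cdot>\<^bsub>Str \<tau>\<^esub> D.extend P (ar H (\<lambda>i. counit (\<CC> i) (A i)) \<cdot>\<^bsub>Str \<tau>\<^esub> w) = w"
proof -
  note \<pi> = D.coalgebraD(2)[OF P] and \<kappa>A = kappa_hom[OF A]
  have wh: "w \<in> Hom (Str \<tau>) (fst P) (ob H (\<lambda>i. C.TO i (A i)))"
    using compat_hom[OF w] by (simp add: cofree_def)
  have H\<epsilon>: "ar H (\<lambda>i. counit (\<CC> i) (A i)) \<in> Hom (Str \<tau>) (ob H (\<lambda>i. C.TO i (A i))) (ob H A)"
    by (rule H_hom) (rule C.counit_hom[OF A])
  note eh = D.extend_hom[OF P Hom_Str_comp[OF wh H\<epsilon>]]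
  show ?thesis
  proof (rule Hom_Str_eqI[OF Hom_Str_comp[OF eh \<kappa>A] wh])
    fix x assume x: "x \<in> carrier (fst P)"
    note \<pi>x = Hom_Str_maps[OF \<pi> x] and wx = Hom_Str_maps[OF wh x]
    note wx' = Hom_Str_maps[OF D.TA_hom[OF wh] \<pi>x]
    have "fn (\<kappa> A \<cdot>\<^bsub>Str \<tau>\<^esub> D.extend P (ar H (\<lambda>i. counit (\<CC> i) (A i)) \<cdot>\<^bsub>Str \<tau>\<^esub> w)) x =
        fn (\<kappa> A) (fn (D.TA (ar H (\<lambda>i. counit (\<CC> i) (A i)))) (fn (D.TA w) (fn (snd P) x)))"
      using Hom_Str_comp_fn[OF eh x] D.extend_fn[OF P x] D.TA_comp_fn[OF wh H\<epsilon> \<pi>x] by simp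
    also have "\<dots> = fn (ar H (\<lambda>i. C.TA i (counit (\<CC> i) (A i))))
        (fn (\<kappa> (\<lambda>i. C.TO i (A i))) (fn (D.TA w) (fn (snd P) x)))"
      by (rule kappa_nat[OF C.counit_hom[OF A] wx'])
    also have "fn (\<kappa> (\<lambda>i. C.TO i (A i))) (fn (D.TA w) (fn (snd P) x)) =
        fn (ar H (\<lambda>i. comult (\<CC> i) (A i))) (fn w x)"
      using w x unfolding compat_iff[OF P C.cofree_coalgebra[OF A]] by (simp add: cofree_def)
    also have "fn (ar H (\<lambda>i. C.TA i (counit (\<CC> i) (A i)))) \<dots> =
        fn (ar H (\<lambda>i. C.TA i (counit (\<CC> i) (A i)) \<cdot>\<^bsub>Str (\<sigma> i)\<^esub> comult (\<CC> i) (A i))) (fn w x)"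
      by (rule H_comp_fn[OF C.comult_hom[OF A] C.TA_hom[OF C.counit_hom[OF A]] wx, symmetric])
    also have "(\<lambda>i. C.TA i (counit (\<CC> i) (A i)) \<cdot>\<^bsub>Str (\<sigma> i)\<^esub> comult (\<CC> i) (A i)) =
        (\<lambda>i. Ident (Str (\<sigma> i)) (C.TO i (A i)))"
      using comonads A by (simp add: comonad_def)
    also have "ar H \<dots> = Ident (Str \<tau>) (ob H (\<lambda>i. C.TO i (A i)))"
      using functor_H Hom_Str_ends(3)[OF C.counit_hom[OF A]]
      by (simp add: is_functor_def product_category_def)
    finally show "fn (\<kappa> A \<cdot>\<^bsub>Str \<tau>\<^esub> D.extend P (ar H (\<lambda>i. counit (\<CC> i) (A i)) \<cdot>\<^bsub>Str \<tau>\<^esub> w)) x = fn w x"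
      using wx by simp
  qed
qed

text \<open>The coalgebra \<open>K\<close> represents the compatible arrows into \<open>H(A\<^sub>1,\<dots>,A\<^sub>n)\<close>. It is the equalizer of the
  two coalgebra morphisms from \<open>cofree \<DD> (H(A\<^sub>1,\<dots>,A\<^sub>n))\<close> induced by \<open>H(\<alpha>\<^sub>1,\<dots>,\<alpha>\<^sub>n) \<circ> \<epsilon>\<close> and \<open>\<kappa>\<close>.\<close>

lemma representing_coalgebra:
  assumes X: "\<And>i. X i \<in> coalgebras (Str (\<sigma> i)) (\<CC> i)"
  obtains K m where "m \<in> D.mors K (cofree \<DD> (ob H (\<lambda>i. fst (X i))))" "m \<in> embeddings \<tau>"
    "counit \<DD> (ob H (\<lambda>i. fst (X i))) \<cdot>\<^bsub>Str \<tau>\<^esub> m \<in> compat K X"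
    "\<And>P f. P \<in> coalgebras (Str \<tau>) \<DD> \<Longrightarrow> f \<in> compat P X \<Longrightarrow>
      \<exists>q. q \<in> D.mors P K \<and> (counit \<DD> (ob H (\<lambda>i. fst (X i))) \<cdot>\<^bsub>Str \<tau>\<^esub> m) \<cdot>\<^bsub>Str \<tau>\<^esub> q = f"
proof -
  let ?HX = "ob H (\<lambda>i. fst (X i))"
  let ?\<epsilon> = "counit \<DD> ?HX" and ?\<alpha> = "ar H (\<lambda>i. snd (X i))" and ?\<kappa> = "\<kappa> (\<lambda>i. fst (X i))"
  have HX: "?HX \<in> structures \<tau>" by (rule H_ob[OF C.coalgebraD(1)[OF X]])
  note \<epsilon> = D.counit_hom[OF HX] and \<kappa> = kappa_hom[OF C.coalgebraD(1)[OF X]]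
    and \<alpha> = H_hom[OF C.coalgebraD(2)[OF X]]
  define E where "E = {y. fn ?\<alpha> (fn ?\<epsilon> y) = fn ?\<kappa> y}"
  have "set_option (point (fst (cofree \<DD> ?HX))) \<subseteq> E"
  proof
    fix a assume "a \<in> set_option (point (fst (cofree \<DD> ?HX)))"
    then have a: "point (D.TO ?HX) = Some a" by (simp add: cofree_def)
    have "point ?HX = Some (fn ?\<epsilon> a)" using Hom_Str_point[OF \<epsilon>] a by simp
    then have "point (ob H (\<lambda>i. C.TO i (fst (X i)))) = Some (fn ?\<alpha> (fn ?\<epsilon> a))"
      using Hom_Str_point[OF \<alpha>] by simp
    moreover have "point (ob H (\<lambda>i. C.TO i (fst (X i)))) = Some (fn ?\<kappa> a)"
      using Hom_Str_point[OF \<kappa>] a by simp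
    ultimately show "a \<in> E" by (simp add: E_def)
  qed
  then obtain K m where m: "m \<in> D.mors K (cofree \<DD> ?HX)" and emb: "m \<in> embeddings \<tau>"
    and mE: "\<And>x. x \<in> carrier (fst K) \<Longrightarrow> fn m x \<in> E"
    and max: "\<And>Z h. h \<in> D.mors Z (cofree \<DD> ?HX) \<Longrightarrow> (\<And>x. x \<in> carrier (fst Z) \<Longrightarrow> fn h x \<in> E) \<Longrightarrow>
      \<exists>k. k \<in> D.mors Z K \<and> m \<cdot>\<^bsub>Str \<tau>\<^esub> k = h"
    by (rule D.largest_subcoalgebra[OF D.cofree_coalgebra[OF HX]]) blast
  note K = D.morsD(1)[OF m]
  have mh: "m \<in> Hom (Str \<tau>) (fst K) (D.TO ?HX)"
    using D.morsD(3)[OF m] by (simp add: cofree_def)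
  have "fn ?\<alpha> (fn (?\<epsilon> \<cdot>\<^bsub>Str \<tau>\<^esub> m) x) = fn ?\<kappa> (fn (D.TA (?\<epsilon> \<cdot>\<^bsub>Str \<tau>\<^esub> m)) (fn (snd K) x))"
    if x: "x \<in> carrier (fst K)" for x
  proof -
    have "fn ?\<alpha> (fn (?\<epsilon> \<cdot>\<^bsub>Str \<tau>\<^esub> m) x) = fn ?\<kappa> (fn m x)"
      using mE[OF x] by (simp add: E_def Hom_Str_comp_fn[OF mh x])
    \<comment> \<open>A morphism into a cofree coalgebra is the extension of its composite with the
      counit; this creates the factor \<open>D.TA\<close> of \<open>?\<epsilon> \<cdot> m\<close>
      that compatibility asks for.\<close>
    also have "fn m x = fn (D.TA (?\<epsilon> \<cdot>\<^bsub>Str \<tau>\<^esub> m)) (fn (snd K) x)"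
      using D.extend_unique[OF m HX] D.extend_fn[OF K x] by metis
    finally show ?thesis .
  qed
  then have compat: "?\<epsilon> \<cdot>\<^bsub>Str \<tau>\<^esub> m \<in> compat K X"
    unfolding compat_iff[OF K X] using Hom_Str_comp[OF mh \<epsilon>] by blast
  have "\<exists>q. q \<in> D.mors P K \<and> (?\<epsilon> \<cdot>\<^bsub>Str \<tau>\<^esub> m) \<cdot>\<^bsub>Str \<tau>\<^esub> q = f"
    if P: "P \<in> coalgebras (Str \<tau>) \<DD>" and f: "f \<in> compat P X" for P f
  proof -
    note fh = compat_hom[OF f]
    \<comment> \<open>Membership in \<open>E\<close> unfolds to the compatibility of
      \<open>f\<close>: the counit turns the extension back into \<open>f\<close> on one side, and
      \<open>?\<kappa>\<close> after the extension is the other side.\<close>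
    have "fn (D.extend P f) x \<in> E" if x: "x \<in> carrier (fst P)" for x
      using f x D.counit_extend[OF P fh x] D.extend_fn[OF P x]
      unfolding compat_iff[OF P X] E_def by simp
    then obtain q where q: "q \<in> D.mors P K" "m \<cdot>\<^bsub>Str \<tau>\<^esub> q = D.extend P f"
      using max[OF D.extend_mors[OF P fh]] by blast
    note qh = D.morsD(3)[OF q(1)]
    have "(?\<epsilon> \<cdot>\<^bsub>Str \<tau>\<^esub> m) \<cdot>\<^bsub>Str \<tau>\<^esub> q = f"
    proof (rule Hom_Str_eqI[OF Hom_Str_comp[OF qh Hom_Str_comp[OF mh \<epsilon>]] fh])
      fix x assume x: "x \<in> carrier (fst P)"
      have "fn ((?\<epsilon> \<cdot>\<^bsub>Str \<tau>\<^esub> m) \<cdot>\<^bsub>Str \<tau>\<^esub> q) x = fn ?\<epsilon> (fn m (fn q x))"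
        using Hom_Str_comp_fn[OF qh x] Hom_Str_comp_fn[OF mh Hom_Str_maps[OF qh x]] by simp
      also have "fn m (fn q x) = fn (D.extend P f) x"
        using Hom_Str_comp_fn[OF qh x, of m] q(2) by simp
      finally show "fn ((?\<epsilon> \<cdot>\<^bsub>Str \<tau>\<^esub> m) \<cdot>\<^bsub>Str \<tau>\<^esub> q) x = fn f x"
        using D.counit_extend[OF P fh x] by simp
    qed
    with q(1) show ?thesis by blast
  qed
  then show ?thesis by (rule that[OF m emb compat])
qed

section \<open>Minimal decompositions, and extensions that are embeddings\<close>

lemma decomposition_iff:
  assumes e: "\<And>i. e i \<in> C.mors i (Q i) (X i)"
  shows "decomposition \<sigma> \<tau> \<CC> \<DD> paths H \<kappa> P X f (\<lambda>i. (Q i, e i, X i)) f0 \<longleftrightarrow>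
    (\<forall>i. e i \<in> embeddings (\<sigma> i) \<and> Q i \<in> paths i) \<and> f0 \<in> compat P Q \<and> f = ar H e \<cdot>\<^bsub>Str \<tau>\<^esub> f0"
  using e unfolding decomposition_def C.path_embedding_iff by auto

text \<open>Condition \<open>S2'\<close> freed from the triples, so that the paths
  \<open>Q i\<close> and the morphisms \<open>e i\<close> can be named separately.\<close>

lemma minimal_decomposition:
  assumes S2': "S2' \<sigma> \<tau> \<CC> \<DD> paths pathsD H \<kappa>"
    and P: "P \<in> pathsD" and X: "\<And>i. X i \<in> coalgebras (Str (\<sigma> i)) (\<CC> i)" and f: "f \<in> compat P X"
  obtains Q e f0 where "\<And>i. e i \<in> C.mors i (Q i) (X i)" "\<And>i. e i \<in> embeddings (\<sigma> i)"
    "\<And>i. Q i \<in> paths i" "f0 \<in> compat P Q" "f = ar H e \<cdot>\<^bsub>Str \<tau>\<^esub> f0"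
    "\<forall>R g g0. (\<forall>i. g i \<in> C.mors i (R i) (X i) \<and> g i \<in> embeddings (\<sigma> i) \<and> R i \<in> paths i) \<longrightarrow>
      g0 \<in> compat P R \<longrightarrow> f = ar H g \<cdot>\<^bsub>Str \<tau>\<^esub> g0 \<longrightarrow>
      (\<exists>h. \<forall>i. h i \<in> C.mors i (Q i) (R i) \<and> e i = g i \<cdot>\<^bsub>Str (\<sigma> i)\<^esub> h i)"
proof -
  obtain e' f0 where dec: "decomposition \<sigma> \<tau> \<CC> \<DD> paths H \<kappa> P X f e' f0"
    and min: "\<And>g g0. decomposition \<sigma> \<tau> \<CC> \<DD> paths H \<kappa> P X f g g0 \<Longrightarrow>
      \<exists>h. \<forall>i. h i \<in> Hom (EM (Str (\<sigma> i)) (\<CC> i)) (fst (e' i)) (fst (g i)) \<and>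
        e' i = g i \<cdot>\<^bsub>EM (Str (\<sigma> i)) (\<CC> i)\<^esub> h i"
    using S2'[unfolded S2'_def, rule_format, OF P _ f] X unfolding EM_sel by blast
  define Q where "Q i = fst (e' i)" for i
  define e where "e i = underlying (e' i)" for i
  have e': "e' = (\<lambda>i. (Q i, e i, X i))"
    using dec by (auto simp: decomposition_def Q_def e_def fun_eq_iff prod_eq_iff)
  have e: "e i \<in> C.mors i (Q i) (X i)" for i
    using dec unfolding e' decomposition_def C.path_embedding_iff by blast
  note dec' = dec[unfolded e' decomposition_iff[OF e]]
  have "\<exists>h. \<forall>i. h i \<in> C.mors i (Q i) (R i) \<and> e i = g i \<cdot>\<^bsub>Str (\<sigma> i)\<^esub> h i"
    if gR: "\<forall>i. g i \<in> C.mors i (R i) (X i) \<and> g i \<in> embeddings (\<sigma> i) \<and> R i \<in> paths i"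
      and "g0 \<in> compat P R" "f = ar H g \<cdot>\<^bsub>Str \<tau>\<^esub> g0" for R g g0
  proof -
    have g: "g i \<in> C.mors i (R i) (X i)" for i using gR by blast
    have "decomposition \<sigma> \<tau> \<CC> \<DD> paths H \<kappa> P X f (\<lambda>i. (R i, g i, X i)) g0"
      unfolding decomposition_iff[OF g] using that by simp
    from min[OF this, unfolded e' fst_conv] obtain h where
      h: "\<And>i. h i \<in> Hom (EM (Str (\<sigma> i)) (\<CC> i)) (Q i) (R i)"
        "\<And>i. (Q i, e i, X i) = (R i, g i, X i) \<cdot>\<^bsub>EM (Str (\<sigma> i)) (\<CC> i)\<^esub> h i"
      by blast
    have "h i = (Q i, underlying (h i), R i)" "h i \<in> Arr (EM (Str (\<sigma> i)) (\<CC> i))" for i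
      using h(1)[of i] by (auto simp: Hom_def prod_eq_iff)
    then have "underlying (h i) \<in> C.mors i (Q i) (R i)" for i
      by (metis mem_Collect_eq)
    moreover have "e i = g i \<cdot>\<^bsub>Str (\<sigma> i)\<^esub> underlying (h i)" for i
      using h(2)[of i] by simp
    ultimately show ?thesis
      by (intro exI[where x = "\<lambda>i. underlying (h i)"]) simp
  qed
  then show ?thesis
    by (intro that[OF e]) (use dec' in auto)
qed

text \<open>The counits are not embeddings, but \<open>w\<close> is recovered from \<open>H(\<epsilon>) \<circ> w\<close> by means of \<open>\<kappa>\<close>, so that the
  extension of \<open>w\<close> factors through that of \<open>H(\<epsilon>) \<circ> w\<close>.\<close>

lemma extend_counit_embedding:
  assumes w: "w \<in> compat P (\<lambda>i. cofree (\<CC> i) (A i))" and P: "P \<in> coalgebras (Str \<tau>) \<DD>"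
    and A: "\<And>i. A i \<in> structures (\<sigma> i)" and emb: "D.extend P w \<in> embeddings \<tau>"
  shows "D.extend P (ar H (\<lambda>i. counit (\<CC> i) (A i)) \<cdot>\<^bsub>Str \<tau>\<^esub> w) \<in> embeddings \<tau>"
proof -
  let ?v = "ar H (\<lambda>i. counit (\<CC> i) (A i)) \<cdot>\<^bsub>Str \<tau>\<^esub> w"
  have wh: "w \<in> Hom (Str \<tau>) (fst P) (ob H (\<lambda>i. C.TO i (A i)))"
    using compat_hom[OF w] by (simp add: cofree_def)
  note vh = Hom_Str_comp[OF wh H_hom[OF C.counit_hom[OF A]]]
  note HA = H_ob[OF A] and \<kappa>A = kappa_hom[OF A] and \<pi> = D.coalgebraD(2)[OF P]
  note eh = D.extend_hom[OF P vh]
  \<comment> \<open>This composite is the extension of \<open>\<kappa> A\<close>, a coalgebra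
    morphism between the cofree coalgebras on \<open>ob H A\<close> and on \<open>H\<close> of the
    \<open>C.TO i (A i)\<close>. Composed with the extension of \<open>?v\<close> it extends
    \<open>w\<close>.\<close>
  have arr: "D.TA (\<kappa> A) \<cdot>\<^bsub>Str \<tau>\<^esub> comult \<DD> (ob H A) \<in>
      Hom (Str \<tau>) (D.TO (ob H A)) (D.TO (ob H (\<lambda>i. C.TO i (A i))))"
    by (rule Hom_Str_comp[OF D.comult_hom[OF HA] D.TA_hom[OF \<kappa>A]])
  have "(D.TA (\<kappa> A) \<cdot>\<^bsub>Str \<tau>\<^esub> comult \<DD> (ob H A)) \<cdot>\<^bsub>Str \<tau>\<^esub> D.extend P ?v = D.extend P w"
  proof (rule Hom_Str_eqI[OF Hom_Str_comp[OF eh arr] D.extend_hom[OF P wh]])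
    fix x assume x: "x \<in> carrier (fst P)"
    note \<pi>x = Hom_Str_maps[OF \<pi> x]
    have "fn ((D.TA (\<kappa> A) \<cdot>\<^bsub>Str \<tau>\<^esub> comult \<DD> (ob H A)) \<cdot>\<^bsub>Str \<tau>\<^esub> D.extend P ?v) x =
        fn (D.TA (\<kappa> A)) (fn (comult \<DD> (ob H A)) (fn (D.extend P ?v) x))"
      using Hom_Str_comp_fn[OF eh x] Hom_Str_comp_fn[OF D.comult_hom[OF HA] Hom_Str_maps[OF eh x]]
      by simp
    also have "fn (comult \<DD> (ob H A)) (fn (D.extend P ?v) x) = fn (D.TA (D.extend P ?v)) (fn (snd P) x)"
      using D.morsD(4)[OF D.extend_mors[OF P vh] x] by (simp add: cofree_def)
    also have "fn (D.TA (\<kappa> A)) \<dots> = fn (D.TA (\<kappa> A \<cdot>\<^bsub>Str \<tau>\<^esub> D.extend P ?v)) (fn (snd P) x)"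
      by (rule D.TA_comp_fn[OF eh \<kappa>A \<pi>x, symmetric])
    also have "\<kappa> A \<cdot>\<^bsub>Str \<tau>\<^esub> D.extend P ?v = w"
      by (rule compat_cofree_eq[OF w P A])
    also have "fn (D.TA w) (fn (snd P) x) = fn (D.extend P w) x"
      by (rule D.extend_fn[OF P x, symmetric])
    finally show "fn ((D.TA (\<kappa> A) \<cdot>\<^bsub>Str \<tau>\<^esub> comult \<DD> (ob H A)) \<cdot>\<^bsub>Str \<tau>\<^esub> D.extend P ?v) x =
        fn (D.extend P w) x" .
  qed
  then show ?thesis
    using embedding_cancel_left[OF arr eh] emb by simp
qed

text \<open>Lets the embedding property of an extension pass along a tuple \<open>e\<close> both
  ways: back to \<open>f\<close> by cancelling \<open>D.TA (ar H e)\<close>, and forward from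
  \<open>f\<close> by composing with it when the \<open>e i\<close> are embeddings.\<close>

lemma extend_H_comp:
  assumes e: "\<And>i. e i \<in> Hom (Str (\<sigma> i)) (A i) (B i)" and f: "f \<in> Hom (Str \<tau>) (fst P) (ob H A)"
    and P: "P \<in> coalgebras (Str \<tau>) \<DD>"
  shows "D.extend P (ar H e \<cdot>\<^bsub>Str \<tau>\<^esub> f) = D.TA (ar H e) \<cdot>\<^bsub>Str \<tau>\<^esub> D.extend P f"
proof (rule Hom_Str_eqI[OF D.extend_hom[OF P Hom_Str_comp[OF f H_hom[OF e]]]
      Hom_Str_comp[OF D.extend_hom[OF P f] D.TA_hom[OF H_hom[OF e]]]])
  fix x assume x: "x \<in> carrier (fst P)"
  show "fn (D.extend P (ar H e \<cdot>\<^bsub>Str \<tau>\<^esub> f)) x = fn (D.TA (ar H e) \<cdot>\<^bsub>Str \<tau>\<^esub> D.extend P f) x"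
    using D.extend_fn[OF P x] Hom_Str_comp_fn[OF D.extend_hom[OF P f] x]
      D.TA_comp_fn[OF f H_hom[OF e] Hom_Str_maps[OF D.coalgebraD(2)[OF P] x]] by simp
qed

end

section \<open>The morphism induced by one family of legs\<close>

locale kleisli_open_map = kleisli_lifting \<tau> \<DD> \<sigma> \<CC> H \<kappa>
  for \<tau> :: "'s signature" and \<DD> :: "('b, 's) str_comonad"
    and \<sigma> :: "'i \<Rightarrow> 'r signature" and \<CC> :: "'i \<Rightarrow> ('a, 'r) str_comonad"
    and H :: "('i, 'a, 'r, 'b, 's) str_functor" and \<kappa> :: "('i \<Rightarrow> ('a, 'r) struc) \<Rightarrow> ('b, 's) morph" +
  fixes paths pathsD X A \<phi> K m u
  assumes S2': "S2' \<sigma> \<tau> \<CC> \<DD> paths pathsD H \<kappa>"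
    and A: "\<And>i. A i \<in> structures (\<sigma> i)"
    and \<phi>: "\<And>i. \<phi> i \<in> C.mors i (X i) (cofree (\<CC> i) (A i))"
    and \<phi>_open: "\<And>i. open_pathwise_embedding (\<sigma> i) (\<CC> i) (paths i) (X i, \<phi> i, cofree (\<CC> i) (A i))"
    and m: "m \<in> D.mors K (cofree \<DD> (ob H (\<lambda>i. fst (X i))))" "m \<in> embeddings \<tau>"
    and u_def: "u = counit \<DD> (ob H (\<lambda>i. fst (X i))) \<cdot>\<^bsub>Str \<tau>\<^esub> m"
    and u_compat: "u \<in> compat K X"
    and represent: "\<And>P f. P \<in> coalgebras (Str \<tau>) \<DD> \<Longrightarrow> f \<in> compat P X \<Longrightarrow>
      \<exists>q. q \<in> D.mors P K \<and> u \<cdot>\<^bsub>Str \<tau>\<^esub> q = f"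
begin

text \<open>By \<open>H_comp_compat\<close>, \<open>ar H \<phi> \<cdot> u\<close> is a compatible
  arrow into the cofree coalgebras on the \<open>A i\<close>. \<open>lift\<close> is the coalgebra
  morphism corresponding to it, so that \<open>\<kappa> A\<close> after \<open>lift\<close> gives it
  back.\<close>

definition "lift = D.extend K (ar H (\<lambda>i. counit (\<CC> i) (A i)) \<cdot>\<^bsub>Str \<tau>\<^esub> ar H \<phi> \<cdot>\<^bsub>Str \<tau>\<^esub> u)"

lemma X_coalgebra: "X i \<in> coalgebras (Str (\<sigma> i)) (\<CC> i)"
  by (rule C.morsD(1)[OF \<phi>])

lemma HX: "ob H (\<lambda>i. fst (X i)) \<in> structures \<tau>"
  by (rule H_ob[OF C.coalgebraD(1)[OF X_coalgebra]])

lemma K_coalgebra: "K \<in> coalgebras (Str \<tau>) \<DD>"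
  by (rule D.morsD(1)[OF m(1)])

lemma u_hom: "u \<in> Hom (Str \<tau>) (fst K) (ob H (\<lambda>i. fst (X i)))"
  by (rule compat_hom[OF u_compat])

lemma m_hom: "m \<in> Hom (Str \<tau>) (fst K) (D.TO (ob H (\<lambda>i. fst (X i))))"
  using D.morsD(3)[OF m(1)] by (simp add: cofree_def)

lemma phi_hom: "\<phi> i \<in> Hom (Str (\<sigma> i)) (fst (X i)) (C.TO i (A i))"
  using C.morsD(3)[OF \<phi>] by (simp add: cofree_def)

lemma H_phi_hom: "ar H \<phi> \<in> Hom (Str \<tau>) (ob H (\<lambda>i. fst (X i))) (ob H (\<lambda>i. C.TO i (A i)))"
  by (rule H_hom[OF phi_hom])

lemma H_counit_hom:
  "ar H (\<lambda>i. counit (\<CC> i) (A i)) \<in> Hom (Str \<tau>) (ob H (\<lambda>i. C.TO i (A i))) (ob H A)"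
  by (rule H_hom[OF C.counit_hom[OF A]])

lemma lift_mors: "lift \<in> D.mors K (cofree \<DD> (ob H A))"
  unfolding lift_def
  by (rule D.extend_mors[OF K_coalgebra Hom_Str_comp[OF Hom_Str_comp[OF u_hom H_phi_hom] H_counit_hom]])

text \<open>Both sides are coalgebra morphisms into a cofree coalgebra with the same composite with
  the counit. When \<open>q\<close> is an embedding so is the right side; the left side expresses
  this through the compatible arrow alone.\<close>

lemma extend_u_comp:
  assumes q: "q \<in> D.mors P K"
  shows "D.extend P (u \<cdot>\<^bsub>Str \<tau>\<^esub> q) = m \<cdot>\<^bsub>Str \<tau>\<^esub> q"
proof (rule D.mors_cofree_eqI[OF D.extend_mors[OF D.morsD(1)[OF q]] D.mors_comp[OF q m(1)] HX])
  show uq: "u \<cdot>\<^bsub>Str \<tau>\<^esub> q \<in> Hom (Str \<tau>) (fst P) (ob H (\<lambda>i. fst (X i)))"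
    by (rule Hom_Str_comp[OF D.morsD(3)[OF q] u_hom])
  fix x assume x: "x \<in> carrier (fst P)"
  note qh = D.morsD(3)[OF q]
  show "fn (counit \<DD> (ob H (\<lambda>i. fst (X i)))) (fn (D.extend P (u \<cdot>\<^bsub>Str \<tau>\<^esub> q)) x) =
      fn (counit \<DD> (ob H (\<lambda>i. fst (X i)))) (fn (m \<cdot>\<^bsub>Str \<tau>\<^esub> q) x)"
    using D.counit_extend[OF D.morsD(1)[OF q] uq x] Hom_Str_comp_fn[OF qh x]
      Hom_Str_comp_fn[OF m_hom Hom_Str_maps[OF qh x]] by (simp add: u_def)
qed

lemma u_mono:
  assumes q: "q \<in> D.mors P K" and q': "q' \<in> D.mors P K" and eq: "u \<cdot>\<^bsub>Str \<tau>\<^esub> q = u \<cdot>\<^bsub>Str \<tau>\<^esub> q'"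
  shows "q = q'"
  by (rule embedding_mono[OF m(2) m_hom D.morsD(3)[OF q] D.morsD(3)[OF q']])
     (metis eq extend_u_comp[OF q] extend_u_comp[OF q'])

lemma counit_lift_fn:
  assumes q: "q \<in> Hom (Str \<tau>) (fst P) (fst K)" and x: "x \<in> carrier (fst P)"
  shows "fn (counit \<DD> (ob H A)) (fn (lift \<cdot>\<^bsub>Str \<tau>\<^esub> q) x) =
    fn (ar H (\<lambda>i. counit (\<CC> i) (A i))) (fn (ar H \<phi>) (fn (u \<cdot>\<^bsub>Str \<tau>\<^esub> q) x))"
  using D.counit_extend[OF K_coalgebra Hom_Str_comp[OF Hom_Str_comp[OF u_hom H_phi_hom] H_counit_hom]
      Hom_Str_maps[OF q x]]
    Hom_Str_comp_fn[OF q x] Hom_Str_comp_fn[OF u_hom Hom_Str_maps[OF q x]]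
    Hom_Str_comp_fn[OF Hom_Str_comp[OF u_hom H_phi_hom] Hom_Str_maps[OF q x]]
  by (simp add: lift_def)

text \<open>Brings out the compatible arrow \<open>u \<cdot> q\<close>, the one to which
  decompositions apply.\<close>

lemma lift_comp:
  assumes q: "q \<in> D.mors P K"
  shows "lift \<cdot>\<^bsub>Str \<tau>\<^esub> q =
    D.extend P (ar H (\<lambda>i. counit (\<CC> i) (A i)) \<cdot>\<^bsub>Str \<tau>\<^esub> ar H \<phi> \<cdot>\<^bsub>Str \<tau>\<^esub> u \<cdot>\<^bsub>Str \<tau>\<^esub> q)"
proof -
  note P = D.morsD(1)[OF q] and qh = D.morsD(3)[OF q]
  note uq = Hom_Str_comp[OF qh u_hom]
  note \<phi>uq = Hom_Str_comp[OF uq H_phi_hom]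
  note \<epsilon>\<phi>uq = Hom_Str_comp[OF \<phi>uq H_counit_hom]
  show ?thesis
  proof (rule D.mors_cofree_eqI[OF D.mors_comp[OF q lift_mors] D.extend_mors[OF P \<epsilon>\<phi>uq] H_ob[OF A]])
    fix x assume x: "x \<in> carrier (fst P)"
    show "fn (counit \<DD> (ob H A)) (fn (lift \<cdot>\<^bsub>Str \<tau>\<^esub> q) x) = fn (counit \<DD> (ob H A)) (fn (D.extend P
        (ar H (\<lambda>i. counit (\<CC> i) (A i)) \<cdot>\<^bsub>Str \<tau>\<^esub> ar H \<phi> \<cdot>\<^bsub>Str \<tau>\<^esub> u \<cdot>\<^bsub>Str \<tau>\<^esub> q)) x)"
      unfolding D.counit_extend[OF P \<epsilon>\<phi>uq x] counit_lift_fn[OF qh x]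
      by (simp only: Hom_Str_comp_fn[OF uq x] Hom_Str_comp_fn[OF \<phi>uq x])
  qed
qed

text \<open>The embedding property travels along extensions. It holds for that of \<open>?f\<close>,
  since this is \<open>m \<cdot> q\<close>; cancellation gives it for \<open>f0\<close>. The
  \<open>\<phi> i\<close> being pathwise-embeddings, \<open>D.TA\<close> of \<open>H\<close> of the
  \<open>\<phi> i \<cdot> e i\<close> is an embedding, which gives it for
  \<open>ar H \<phi> \<cdot> ?f\<close>. The last step removes the counits.\<close>

lemma lift_pathwise:
  assumes P: "P \<in> pathsD" and q: "q \<in> D.mors P K" "q \<in> embeddings \<tau>"
  shows "lift \<cdot>\<^bsub>Str \<tau>\<^esub> q \<in> embeddings \<tau>"
proof -
  note PD = D.morsD(1)[OF q(1)]
  let ?f = "u \<cdot>\<^bsub>Str \<tau>\<^esub> q"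
  note f = compat_comp_mors[OF q(1) u_compat X_coalgebra]
  obtain Q e f0 where e: "\<And>i. e i \<in> C.mors i (Q i) (X i)" "\<And>i. e i \<in> embeddings (\<sigma> i)"
    and Q: "\<And>i. Q i \<in> paths i" and f0: "f0 \<in> compat P Q" and fe: "?f = ar H e \<cdot>\<^bsub>Str \<tau>\<^esub> f0"
    by (rule minimal_decomposition[OF S2' P X_coalgebra f]) (rule that)
  note eh = C.morsD(3)[OF e(1)] and f0h = compat_hom[OF f0]
  have "D.extend P ?f \<in> embeddings \<tau>"
    unfolding extend_u_comp[OF q(1)]
    by (rule embedding_comp[OF m_hom m(2) D.morsD(3)[OF q(1)] q(2)])
  then have f0_emb: "D.extend P f0 \<in> embeddings \<tau>"
    unfolding fe extend_H_comp[OF eh f0h PD]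
    by (rule embedding_cancel_left[OF D.TA_hom[OF H_hom[OF eh]] D.extend_hom[OF PD f0h]])
  have \<phi>e: "\<phi> i \<cdot>\<^bsub>Str (\<sigma> i)\<^esub> e i \<in> embeddings (\<sigma> i)" for i
    using \<phi>_open[of i] Q e unfolding C.open_pathwise_embedding_iff[OF \<phi>] by blast
  note \<phi>eh = Hom_Str_comp[OF eh phi_hom]
  have "ar H \<phi> \<cdot>\<^bsub>Str \<tau>\<^esub> ?f = ar H (\<lambda>i. \<phi> i \<cdot>\<^bsub>Str (\<sigma> i)\<^esub> e i) \<cdot>\<^bsub>Str \<tau>\<^esub> f0"
    unfolding fe H_comp[OF eh phi_hom]
    by (rule Hom_Str_assoc[OF f0h H_hom[OF eh] H_phi_hom])
  then have "D.extend P (ar H \<phi> \<cdot>\<^bsub>Str \<tau>\<^esub> ?f) =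
      D.TA (ar H (\<lambda>i. \<phi> i \<cdot>\<^bsub>Str (\<sigma> i)\<^esub> e i)) \<cdot>\<^bsub>Str \<tau>\<^esub> D.extend P f0"
    using extend_H_comp[OF \<phi>eh f0h PD] by simp
  moreover have "\<dots> \<in> embeddings \<tau>"
    by (rule embedding_comp[OF D.TA_hom[OF H_hom[OF \<phi>eh]] D.TA_emb[OF H_emb[OF \<phi>e]]
          D.extend_hom[OF PD f0h] f0_emb])
  ultimately have "D.extend P (ar H \<phi> \<cdot>\<^bsub>Str \<tau>\<^esub> ?f) \<in> embeddings \<tau>" by simp
  then show ?thesis
    unfolding lift_comp[OF q(1)]
    by (rule extend_counit_embedding[OF H_comp_compat[OF \<phi> f PD] PD A])
qed

text \<open>By minimality, the decomposition of \<open>\<kappa> \<circ> r \<circ> g\<close> through \<open>e'\<close> refines both the one through \<open>\<phi> \<circ> e\<close> and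
  the one through \<open>t\<close>. This gives squares \<open>\<phi> \<circ> (e \<circ> h1) = t \<circ> h2\<close> to which openness of \<open>\<phi>\<close> applies.\<close>

lemma lift_open:
  assumes P: "P \<in> pathsD" and Q: "Q \<in> pathsD" and q: "q \<in> D.mors P K" "q \<in> embeddings \<tau>"
    and r: "r \<in> D.mors Q (cofree \<DD> (ob H A))" "r \<in> embeddings \<tau>" and g: "g \<in> D.mors P Q"
    and eq: "lift \<cdot>\<^bsub>Str \<tau>\<^esub> q = r \<cdot>\<^bsub>Str \<tau>\<^esub> g"
  shows "\<exists>d \<in> D.mors Q K. q = d \<cdot>\<^bsub>Str \<tau>\<^esub> g \<and> r = lift \<cdot>\<^bsub>Str \<tau>\<^esub> d"
proof -
  note PD = D.morsD(1)[OF q(1)] and QD = D.morsD(1)[OF r(1)] and gh = D.morsD(3)[OF g]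
  note cofree = C.cofree_coalgebra[OF A] and \<kappa>A = kappa_hom[OF A]
  have rh: "r \<in> Hom (Str \<tau>) (fst Q) (D.TO (ob H A))"
    using D.morsD(3)[OF r(1)] by (simp add: cofree_def)
  let ?f = "u \<cdot>\<^bsub>Str \<tau>\<^esub> q" and ?r' = "\<kappa> A \<cdot>\<^bsub>Str \<tau>\<^esub> r"
  note f = compat_comp_mors[OF q(1) u_compat X_coalgebra]
  note r' = kappa_comp_compat[OF r(1) A]
  note r'g = compat_comp_mors[OF g r' cofree]
  \<comment> \<open>Composing both sides of \<open>eq\<close> with \<open>\<kappa> A\<close> moves
    the square from coalgebra morphisms to compatible arrows.\<close>
  have \<phi>f: "ar H \<phi> \<cdot>\<^bsub>Str \<tau>\<^esub> ?f = ?r' \<cdot>\<^bsub>Str \<tau>\<^esub> g"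
    using compat_cofree_eq[OF H_comp_compat[OF \<phi> f PD] PD A] Hom_Str_assoc[OF gh rh \<kappa>A]
    unfolding lift_comp[OF q(1), symmetric] eq by simp
  obtain R t r0 where t: "\<And>i. t i \<in> C.mors i (R i) (cofree (\<CC> i) (A i))" "\<And>i. t i \<in> embeddings (\<sigma> i)"
    and R: "\<And>i. R i \<in> paths i" and r0: "r0 \<in> compat Q R" and rt: "?r' = ar H t \<cdot>\<^bsub>Str \<tau>\<^esub> r0"
    by (rule minimal_decomposition[OF S2' Q cofree r']) (rule that)
  obtain S e f0 where e: "\<And>i. e i \<in> C.mors i (S i) (X i)" "\<And>i. e i \<in> embeddings (\<sigma> i)"
    and S: "\<And>i. S i \<in> paths i" and f0: "f0 \<in> compat P S" and fe: "?f = ar H e \<cdot>\<^bsub>Str \<tau>\<^esub> f0"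
    by (rule minimal_decomposition[OF S2' P X_coalgebra f]) (rule that)
  obtain S' e' f0' where e': "\<And>i. e' i \<in> C.mors i (S' i) (cofree (\<CC> i) (A i))"
      "\<And>i. e' i \<in> embeddings (\<sigma> i)"
    and S': "\<And>i. S' i \<in> paths i" and f0': "f0' \<in> compat P S'"
    and r'ge: "?r' \<cdot>\<^bsub>Str \<tau>\<^esub> g = ar H e' \<cdot>\<^bsub>Str \<tau>\<^esub> f0'"
    and min: "\<forall>R g' g0. (\<forall>i. g' i \<in> C.mors i (R i) (cofree (\<CC> i) (A i)) \<and> g' i \<in> embeddings (\<sigma> i) \<and>
        R i \<in> paths i) \<longrightarrow> g0 \<in> compat P R \<longrightarrow> ?r' \<cdot>\<^bsub>Str \<tau>\<^esub> g = ar H g' \<cdot>\<^bsub>Str \<tau>\<^esub> g0 \<longrightarrow>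
      (\<exists>h. \<forall>i. h i \<in> C.mors i (S' i) (R i) \<and> e' i = g' i \<cdot>\<^bsub>Str (\<sigma> i)\<^esub> h i)"
    by (rule minimal_decomposition[OF S2' P cofree r'g]) (rule that)
  note th = C.morsD(3)[OF t(1)] and eh = C.morsD(3)[OF e(1)]
  have th': "t i \<in> Hom (Str (\<sigma> i)) (fst (R i)) (C.TO i (A i))" for i
    using th[of i] by (simp add: cofree_def)
  note r0h = compat_hom[OF r0] and f0h = compat_hom[OF f0] and f0'h = compat_hom[OF f0']
  have \<phi>e: "\<phi> i \<cdot>\<^bsub>Str (\<sigma> i)\<^esub> e i \<in> embeddings (\<sigma> i)" for i
    using \<phi>_open[of i] S e unfolding C.open_pathwise_embedding_iff[OF \<phi>] by blast
  note \<phi>e_mors = C.mors_comp[OF e(1) \<phi>] and \<phi>eh = Hom_Str_comp[OF eh phi_hom]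
  have \<phi>f_e: "?r' \<cdot>\<^bsub>Str \<tau>\<^esub> g = ar H (\<lambda>i. \<phi> i \<cdot>\<^bsub>Str (\<sigma> i)\<^esub> e i) \<cdot>\<^bsub>Str \<tau>\<^esub> f0"
    unfolding \<phi>f[symmetric] fe H_comp[OF eh phi_hom]
    by (rule Hom_Str_assoc[OF f0h H_hom[OF eh] H_phi_hom])
  obtain h1 where h1: "\<And>i. h1 i \<in> C.mors i (S' i) (S i)"
    and e'h1: "\<And>i. e' i = (\<phi> i \<cdot>\<^bsub>Str (\<sigma> i)\<^esub> e i) \<cdot>\<^bsub>Str (\<sigma> i)\<^esub> h1 i"
    using min[rule_format, OF conjI[OF \<phi>e_mors conjI[OF \<phi>e S]] f0 \<phi>f_e] by blast
  have r'g_t: "?r' \<cdot>\<^bsub>Str \<tau>\<^esub> g = ar H t \<cdot>\<^bsub>Str \<tau>\<^esub> r0 \<cdot>\<^bsub>Str \<tau>\<^esub> g"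
    unfolding rt by (rule Hom_Str_assoc[OF gh r0h H_hom[OF th], symmetric])
  obtain h2 where h2: "\<And>i. h2 i \<in> C.mors i (S' i) (R i)"
    and e'h2: "\<And>i. e' i = t i \<cdot>\<^bsub>Str (\<sigma> i)\<^esub> h2 i"
    using min[rule_format, OF conjI[OF t(1) conjI[OF t(2) R]]
        compat_comp_mors[OF g r0 C.morsD(1)[OF t(1)]] r'g_t] by blast
  note h1h = C.morsD(3)[OF h1] and h2h = C.morsD(3)[OF h2]
  \<comment> \<open>Openness of \<open>\<phi> i\<close> is tested on path embeddings into
    \<open>X i\<close>, so \<open>e i \<cdot> h1 i\<close> must be an embedding. For
    \<open>h1 i\<close> this is inherited from \<open>e' i\<close>.\<close>
  have h1_emb: "h1 i \<in> embeddings (\<sigma> i)" for i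
    by (rule embedding_cancel_left[OF \<phi>eh h1h]) (use e'(2) e'h1 in metis)
  have eh1_emb: "e i \<cdot>\<^bsub>Str (\<sigma> i)\<^esub> h1 i \<in> embeddings (\<sigma> i)" for i
    by (rule embedding_comp[OF eh e(2) h1h h1_emb])
  have square: "\<phi> i \<cdot>\<^bsub>Str (\<sigma> i)\<^esub> e i \<cdot>\<^bsub>Str (\<sigma> i)\<^esub> h1 i = t i \<cdot>\<^bsub>Str (\<sigma> i)\<^esub> h2 i" for i
    using Hom_Str_assoc[OF h1h eh phi_hom, of i] e'h1[of i] e'h2[of i] by simp
  have "\<exists>d. d \<in> C.mors i (R i) (X i) \<and> e i \<cdot>\<^bsub>Str (\<sigma> i)\<^esub> h1 i = d \<cdot>\<^bsub>Str (\<sigma> i)\<^esub> h2 i \<and>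
      t i = \<phi> i \<cdot>\<^bsub>Str (\<sigma> i)\<^esub> d" for i
    using C.open_pathwise_embedding_iff[OF \<phi>, THEN iffD1, OF \<phi>_open, THEN conjunct1, rule_format,
        OF S'[of i] R C.mors_comp[OF h1 e(1)] eh1_emb t h2 square] by blast
  then obtain d where d: "\<And>i. d i \<in> C.mors i (R i) (X i)"
    and dh2: "\<And>i. e i \<cdot>\<^bsub>Str (\<sigma> i)\<^esub> h1 i = d i \<cdot>\<^bsub>Str (\<sigma> i)\<^esub> h2 i"
    and td: "\<And>i. t i = \<phi> i \<cdot>\<^bsub>Str (\<sigma> i)\<^esub> d i"
    by metis
  note dh = C.morsD(3)[OF d]
  \<comment> \<open>The diagonal filler: the diagonals \<open>d i\<close> together with
    \<open>r0\<close> form a compatible arrow out of \<open>Q\<close>, which \<open>K\<close>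
    represents by \<open>k\<close>.\<close>
  obtain k where k: "k \<in> D.mors Q K" and uk: "u \<cdot>\<^bsub>Str \<tau>\<^esub> k = ar H d \<cdot>\<^bsub>Str \<tau>\<^esub> r0"
    using represent[OF QD H_comp_compat[OF d r0 QD]] by blast
  note kh = D.morsD(3)[OF k]
  \<comment> \<open>Minimality relates \<open>e'\<close> to the other path embeddings but says
    nothing about the factors from \<open>P\<close>. These are compared after \<open>H\<close> of a
    tuple of embeddings, which is an embedding and can be cancelled; \<open>r0g_eq\<close> uses the
    same device.\<close>
  have f0_eq: "f0 = ar H h1 \<cdot>\<^bsub>Str \<tau>\<^esub> f0'"
  proof (rule embedding_mono[OF H_emb[OF \<phi>e] H_hom[OF \<phi>eh] f0h Hom_Str_comp[OF f0'h H_hom[OF h1h]]])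
    have "ar H e' = ar H (\<lambda>i. \<phi> i \<cdot>\<^bsub>Str (\<sigma> i)\<^esub> e i) \<cdot>\<^bsub>Str \<tau>\<^esub> ar H h1"
      using H_comp[OF h1h \<phi>eh] e'h1 by (metis (no_types, lifting) ext)
    then show "ar H (\<lambda>i. \<phi> i \<cdot>\<^bsub>Str (\<sigma> i)\<^esub> e i) \<cdot>\<^bsub>Str \<tau>\<^esub> f0 =
        ar H (\<lambda>i. \<phi> i \<cdot>\<^bsub>Str (\<sigma> i)\<^esub> e i) \<cdot>\<^bsub>Str \<tau>\<^esub> ar H h1 \<cdot>\<^bsub>Str \<tau>\<^esub> f0'"
      using \<phi>f_e r'ge Hom_Str_assoc[OF f0'h H_hom[OF h1h] H_hom[OF \<phi>eh]] by simp
  qed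
  have r0g_eq: "r0 \<cdot>\<^bsub>Str \<tau>\<^esub> g = ar H h2 \<cdot>\<^bsub>Str \<tau>\<^esub> f0'"
  proof (rule embedding_mono[OF H_emb[OF t(2)] H_hom[OF th] Hom_Str_comp[OF gh r0h]
        Hom_Str_comp[OF f0'h H_hom[OF h2h]]])
    have "ar H e' = ar H t \<cdot>\<^bsub>Str \<tau>\<^esub> ar H h2"
      using H_comp[OF h2h th] e'h2 by (metis (no_types, lifting) ext)
    then show "ar H t \<cdot>\<^bsub>Str \<tau>\<^esub> r0 \<cdot>\<^bsub>Str \<tau>\<^esub> g = ar H t \<cdot>\<^bsub>Str \<tau>\<^esub> ar H h2 \<cdot>\<^bsub>Str \<tau>\<^esub> f0'"
      using r'g_t r'ge Hom_Str_assoc[OF f0'h H_hom[OF h2h] H_hom[OF th]] by simp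
  qed
  have "u \<cdot>\<^bsub>Str \<tau>\<^esub> q = ar H e \<cdot>\<^bsub>Str \<tau>\<^esub> ar H h1 \<cdot>\<^bsub>Str \<tau>\<^esub> f0'"
    unfolding fe f0_eq ..
  also have "\<dots> = ar H (\<lambda>i. e i \<cdot>\<^bsub>Str (\<sigma> i)\<^esub> h1 i) \<cdot>\<^bsub>Str \<tau>\<^esub> f0'"
    unfolding H_comp[OF h1h eh] by (rule Hom_Str_assoc[OF f0'h H_hom[OF h1h] H_hom[OF eh]])
  also have "\<dots> = ar H d \<cdot>\<^bsub>Str \<tau>\<^esub> ar H h2 \<cdot>\<^bsub>Str \<tau>\<^esub> f0'"
    unfolding dh2 H_comp[OF h2h dh] by (rule Hom_Str_assoc[OF f0'h H_hom[OF h2h] H_hom[OF dh], symmetric])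
  also have "\<dots> = (u \<cdot>\<^bsub>Str \<tau>\<^esub> k) \<cdot>\<^bsub>Str \<tau>\<^esub> g"
    unfolding uk r0g_eq[symmetric] by (rule Hom_Str_assoc[OF gh r0h H_hom[OF dh]])
  also have "\<dots> = u \<cdot>\<^bsub>Str \<tau>\<^esub> k \<cdot>\<^bsub>Str \<tau>\<^esub> g"
    by (rule Hom_Str_assoc[OF gh kh u_hom, symmetric])
  finally have "q = k \<cdot>\<^bsub>Str \<tau>\<^esub> g"
    by (rule u_mono[OF q(1) D.mors_comp[OF g k]])
  \<comment> \<open>It suffices to compare composites with the counit. There
    \<open>ar H \<phi>\<close> after \<open>u \<cdot> k\<close> is \<open>ar H t\<close> after
    \<open>r0\<close>, that is, \<open>\<kappa> A\<close> after \<open>r\<close>, and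
    \<open>H\<close> of the counits after \<open>\<kappa> A\<close> is the counit of \<DD>.\<close>
  moreover have "r = lift \<cdot>\<^bsub>Str \<tau>\<^esub> k"
  proof (rule D.mors_cofree_eqI[OF r(1) D.mors_comp[OF k lift_mors] H_ob[OF A]])
    fix x assume x: "x \<in> carrier (fst Q)"
    note r0x = Hom_Str_maps[OF r0h x]
    have "fn (ar H \<phi>) (fn (u \<cdot>\<^bsub>Str \<tau>\<^esub> k) x) = fn (ar H (\<lambda>i. \<phi> i \<cdot>\<^bsub>Str (\<sigma> i)\<^esub> d i)) (fn r0 x)"
      unfolding uk Hom_Str_comp_fn[OF r0h x] by (rule H_comp_fn[OF dh phi_hom r0x, symmetric])
    also have "\<dots> = fn ?r' x"
      unfolding rt Hom_Str_comp_fn[OF r0h x] td[symmetric] ..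
    also have "\<dots> = fn (\<kappa> A) (fn r x)"
      by (rule Hom_Str_comp_fn[OF rh x])
    finally show "fn (counit \<DD> (ob H A)) (fn r x) = fn (counit \<DD> (ob H A)) (fn (lift \<cdot>\<^bsub>Str \<tau>\<^esub> k) x)"
      using counit_lift_fn[OF kh x] kappa_counit[OF A Hom_Str_maps[OF rh x]] by simp
  qed
  ultimately show ?thesis using k by blast
qed

lemma lift_open_pathwise_embedding:
  "open_pathwise_embedding \<tau> \<DD> pathsD (K, lift, cofree \<DD> (ob H A))"
  unfolding D.open_pathwise_embedding_iff[OF lift_mors]
  using lift_open lift_pathwise by blast

end

theorem theorem6:
  fixes \<sigma> :: "'i::finite \<Rightarrow> 'r signature" and \<tau> :: "'s signature"
    and \<CC> :: "'i \<Rightarrow> ('a, 'r) str_comonad" and \<DD> :: "('b, 's) str_comonad"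
    and paths :: "'i \<Rightarrow> ('a, 'r) str_coalg set" and pathsD :: "('b, 's) str_coalg set"
    and H :: "('i, 'a, 'r, 'b, 's) str_functor"
    and A B :: "'i \<Rightarrow> ('a, 'r) struc"
  assumes "\<And>i. comonad (Str (\<sigma> i)) (\<CC> i)"
    and "comonad (Str \<tau>) \<DD>"
    and "comonad_preserves_embeddings \<tau> \<DD>"
    and "\<And>i. paths i \<subseteq> Obj (EM (Str (\<sigma> i)) (\<CC> i))"
    and "pathsD \<subseteq> Obj (EM (Str \<tau>) \<DD>)"
    and "is_functor (product_category (\<lambda>i. Str (\<sigma> i))) (Str \<tau>) H"
    and "functor_preserves_embeddings \<sigma> \<tau> H"
    and "\<exists>\<kappa>. kleisli_law (\<lambda>i. Str (\<sigma> i)) (Str \<tau>) \<CC> \<DD> H \<kappa> \<and>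
             S2' \<sigma> \<tau> \<CC> \<DD> paths pathsD H \<kappa>"
    and "\<And>i. A i \<in> structures (\<sigma> i)" and "\<And>i. B i \<in> structures (\<sigma> i)"
    and "\<And>i. comonad_equiv (\<sigma> i) (\<CC> i) (paths i) (A i) (B i)"
  shows "comonad_equiv \<tau> \<DD> pathsD (ob H A) (ob H B)"
proof -
  obtain \<kappa> where \<kappa>: "kleisli_law (\<lambda>i. Str (\<sigma> i)) (Str \<tau>) \<CC> \<DD> H \<kappa>"
    and S2': "S2' \<sigma> \<tau> \<CC> \<DD> paths pathsD H \<kappa>"
    using assms(8) by blast
  interpret kleisli_lifting \<tau> \<DD> \<sigma> \<CC> H \<kappa>
    by unfold_locales (fact assms \<kappa>)+
  have "\<exists>X f g. f \<in> C.mors i X (cofree (\<CC> i) (A i)) \<and> g \<in> C.mors i X (cofree (\<CC> i) (B i)) \<and>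
      open_pathwise_embedding (\<sigma> i) (\<CC> i) (paths i) (X, f, cofree (\<CC> i) (A i)) \<and>
      open_pathwise_embedding (\<sigma> i) (\<CC> i) (paths i) (X, g, cofree (\<CC> i) (B i))" for i
  proof -
    obtain X f g where f: "f \<in> Hom (EM (Str (\<sigma> i)) (\<CC> i)) X (cofree (\<CC> i) (A i))"
      and g: "g \<in> Hom (EM (Str (\<sigma> i)) (\<CC> i)) X (cofree (\<CC> i) (B i))"
      and "open_pathwise_embedding (\<sigma> i) (\<CC> i) (paths i) f"
        "open_pathwise_embedding (\<sigma> i) (\<CC> i) (paths i) g"
      using assms(11)[of i] unfolding comonad_equiv_def by blast
    moreover have "f = (X, underlying f, cofree (\<CC> i) (A i))" "g = (X, underlying g, cofree (\<CC> i) (B i))"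
      using f g by (auto simp: Hom_def prod_eq_iff)
    ultimately show ?thesis
      unfolding Hom_def by (metis (mono_tags, lifting) mem_Collect_eq)
  qed
  then obtain X f g where f: "\<And>i. f i \<in> C.mors i (X i) (cofree (\<CC> i) (A i))"
    and g: "\<And>i. g i \<in> C.mors i (X i) (cofree (\<CC> i) (B i))"
    and f_open: "\<And>i. open_pathwise_embedding (\<sigma> i) (\<CC> i) (paths i) (X i, f i, cofree (\<CC> i) (A i))"
    and g_open: "\<And>i. open_pathwise_embedding (\<sigma> i) (\<CC> i) (paths i) (X i, g i, cofree (\<CC> i) (B i))"
    by metis
  \<comment> \<open>The construction depends on the apexes \<open>X i\<close> only, so it can be
    fixed before either family of legs is lifted.\<close>
  obtain K m where m: "m \<in> D.mors K (cofree \<DD> (ob H (\<lambda>i. fst (X i))))" "m \<in> embeddings \<tau>"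
    and u: "counit \<DD> (ob H (\<lambda>i. fst (X i))) \<cdot>\<^bsub>Str \<tau>\<^esub> m \<in> compat K X"
    and represent: "\<And>P f. P \<in> coalgebras (Str \<tau>) \<DD> \<Longrightarrow> f \<in> compat P X \<Longrightarrow>
      \<exists>q. q \<in> D.mors P K \<and> (counit \<DD> (ob H (\<lambda>i. fst (X i))) \<cdot>\<^bsub>Str \<tau>\<^esub> m) \<cdot>\<^bsub>Str \<tau>\<^esub> q = f"
    by (rule representing_coalgebra[OF C.morsD(1)[OF f]]) (rule that)
  interpret FA: kleisli_open_map \<tau> \<DD> \<sigma> \<CC> H \<kappa> paths pathsD X A f K m
      "counit \<DD> (ob H (\<lambda>i. fst (X i))) \<cdot>\<^bsub>Str \<tau>\<^esub> m"
    by unfold_locales (fact S2' assms(9) f f_open m u represent refl)+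
  interpret FB: kleisli_open_map \<tau> \<DD> \<sigma> \<CC> H \<kappa> paths pathsD X B g K m
      "counit \<DD> (ob H (\<lambda>i. fst (X i))) \<cdot>\<^bsub>Str \<tau>\<^esub> m"
    by unfold_locales (fact S2' assms(10) g g_open m u represent refl)+
  show ?thesis
    unfolding comonad_equiv_def
  proof (intro bexI conjI)
    show "open_pathwise_embedding \<tau> \<DD> pathsD (K, FA.lift, cofree \<DD> (ob H A))"
      by (rule FA.lift_open_pathwise_embedding)
    show "open_pathwise_embedding \<tau> \<DD> pathsD (K, FB.lift, cofree \<DD> (ob H B))"
      by (rule FB.lift_open_pathwise_embedding)
    show "(K, FA.lift, cofree \<DD> (ob H A)) \<in> Hom (EM (Str \<tau>) \<DD>) K (cofree \<DD> (ob H A))"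
      using FA.lift_mors by (simp add: Hom_def)
    show "(K, FB.lift, cofree \<DD> (ob H B)) \<in> Hom (EM (Str \<tau>) \<DD>) K (cofree \<DD> (ob H B))"
      using FB.lift_mors by (simp add: Hom_def)
    show "K \<in> Obj (EM (Str \<tau>) \<DD>)"
      using FA.K_coalgebra by simp
  qed
qed

end
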